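(* Let $\Sigma$ be a finite signature, let $\mathrm{w}$ be an MSO-friendly width measure for $\Sigma$, and let $\mathcal{R}$ be a finite-$\mathrm{w}$ set of existential rules over $\Sigma$. Then the following problem is decidable: given a database $\mathcal{D}$ over $\Sigma$ and a DaMSOQ $(\mathfrak{q},\Xi)$ over $\Sigma$, decide whether $(\mathcal{D},\mathcal{R})\models(\mathfrak{q},\Xi)$.
   Context: Fix disjoint countably infinite sets of constants and nulls. A signature $\Sigma$ is a finite set of predicates with arities. An instance over $\Sigma$ is a countable set of atoms $R(t_1,\dots,t_k)$ with $R\in\Sigma$ of arity $k$ and each $t_i$ a constant or a null; $\mathrm{adom}(I)$ is the set of terms occurring in $I$. A database is a finite instance containing only constants. A homomorphism from an instance $I$ to an instance $J$ is a map $\mathrm{adom}(I)\to\mathrm{adom}(J)$ that is the identity on constants and maps each atom of $I$ to an atom of $J$. An existential rule is a sentence $\forall\vec x\forall\vec y\,(B(\vec x,\vec y)\to\exists\vec z\,H(\vec y,\vec z))$ with $B,H$ conjunctions of atoms; it is a datalog rule if $\vec z$ is empty. An instance $I$ is a model of $(\mathcal{D},\mathcal{R})$ ($\mathcal{D}$ a database, $\mathcal{R}$ a finite rule set) if $\mathcal{D}\subseteq I$ and $I$ satisfies every rule of $\mathcal{R}$; a universal model of $(\mathcal{D},\mathcal{R})$ is a model that has a homomorphism into every model of $(\mathcal{D},\mathcal{R})$. A (Boolean) datalog query $\mathfrak{q}$ over $\Sigma$ is a finite set $\mathcal{R}_{\mathfrak{q}}$ of datalog rules over $\Sigma_{\mathrm{EDB}}\uplus\Sigma_{\mathrm{IDB}}$,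 where $\Sigma_{\mathrm{EDB}}\subseteq\Sigma$, $\Sigma_{\mathrm{IDB}}\cap\Sigma=\emptyset$, no $\Sigma_{\mathrm{EDB}}$-atom occurs in a rule head, and $\Sigma_{\mathrm{IDB}}$ contains a nullary predicate $\mathtt{Goal}$; an instance $I$ satisfies $\mathfrak{q}$ iff $\mathtt{Goal}$ belongs to the least instance containing $I$ closed under the rules of $\mathcal{R}_{\mathfrak{q}}$. A DaMSOQ (datalog/MSO query) over $\Sigma$ is a pair $(\mathfrak{q},\Xi)$ where $\mathfrak{q}$ is a datalog query over $\Sigma$ and $\Xi$ is a monadic second-order sentence over $\Sigma$ (with constants) satisfied by exactly the same instances as $\mathfrak{q}$. $(\mathcal{D},\mathcal{R})\models(\mathfrak{q},\Xi)$ means every model of $(\mathcal{D},\mathcal{R})$ satisfies $\mathfrak{q}$ (equivalently $\Xi$). A width measure for $\Sigma$ is a function $\mathrm{w}$ from countable instances over $\Sigma$ to $\mathbb{N}\cup\{\infty\}$. It is MSO-friendly if there is an algorithm that, on input $n\in\mathbb{N}$ and an MSO sentence $\Xi$, never terminates if $\Xi$ is unsatisfiable and always terminates if $\Xi$ has a model $I$ with $\mathrm{w}(I)\le n$. A rule set $\mathcal{R}$ is a finite-$\mathrm{w}$ set if for every database $\mathcal{D}$ there is a universal model $I^*$ of $(\mathcal{D},\mathcal{R})$ with $\mathrm{w}(I^* )\in\mathbb{N}$. *)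

theory Defs
  imports "HOL-Library.Countable" "HOL-Library.Extended_Nat" "HOL-Library.Nat_Bijection"
begin

section \<open>Partial recursive functions\<close>

datatype recf = Zero | Succ | Proj nat | Comp recf "recf list" | Prec recf recf | Mini recf

text \<open>\<open>computes f xs y\<close>: the program \<open>f\<close>, run on the argument list \<open>xs\<close>, halts with result \<open>y\<close>.
  In primitive recursion and in unbounded minimisation, the distinguished argument is the first one.\<close>

inductive computes :: "recf \<Rightarrow> nat list \<Rightarrow> nat \<Rightarrow> bool" where
  zero: "computes Zero xs 0"
| succ: "computes Succ [x] (Suc x)"
| proj: "i < length xs \<Longrightarrow> computes (Proj i) xs (xs ! i)"
| comp: "list_all2 (\<lambda>g y. computes g xs y) gs ys \<Longrightarrow> computes f ys z \<Longrightarrow> computes (Comp f gs) xs z"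
| prec_0: "computes f xs y \<Longrightarrow> computes (Prec f g) (0 # xs) y"
| prec_Suc: "computes (Prec f g) (n # xs) y \<Longrightarrow> computes g (n # y # xs) z \<Longrightarrow>
    computes (Prec f g) (Suc n # xs) z"
| mini: "computes f (n # xs) 0 \<Longrightarrow> (\<forall>m<n. \<exists>k. computes f (m # xs) (Suc k)) \<Longrightarrow>
    computes (Mini f) xs n"

definition halts :: "recf \<Rightarrow> nat list \<Rightarrow> bool" where
  "halts f xs \<longleftrightarrow> (\<exists>y. computes f xs y)"

inductive_cases computesE:
  "computes Zero xs y" "computes Succ xs y" "computes (Proj i) xs y" "computes (Comp f gs) xs y"
  "computes (Prec f g) (0 # xs) y" "computes (Prec f g) (Suc n # xs) y" "computes (Mini f) xs y"

lemma computes_deterministic: "computes f xs y \<Longrightarrow> computes f xs z \<Longrightarrow> y = z"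
proof (induction arbitrary: z rule: computes.induct)
  case (comp xs gs ys f y)
  from comp.prems obtain zs where zs: "list_all2 (\<lambda>g y. computes g xs y) gs zs" "computes f zs z"
    by (rule computesE(4))
  have "ys = zs"
    using comp.IH(1) zs(1) by (auto simp: list_all2_conv_all_nth intro!: nth_equalityI)
  then show ?case using comp.IH(2) zs(2) by blast
next
  case (prec_Suc f g n xs y z')
  from prec_Suc.prems obtain u where "computes (Prec f g) (n # xs) u" "computes g (n # u # xs) z"
    by (rule computesE(6))
  then show ?case using prec_Suc.IH by blast
next
  case (mini f n xs)
  from mini.prems have z: "computes f (z # xs) 0" "\<forall>m<z. \<exists>k. computes f (m # xs) (Suc k)"
    by (blast elim: computesE(7))+
  show ?case
  proof (cases n z rule: linorder_cases)
    case less
    then obtain k where "computes f (n # xs) (Suc k)" using z(2) by blast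
    then show ?thesis using mini.IH(1) by blast
  next
    case greater
    then show ?thesis using mini.IH(2) z(1) by blast
  qed simp
qed (blast elim: computesE)+

text \<open>Decidability of \<open>Q\<close> for inputs from the class \<open>A\<close>, presented through the encoding \<open>enc\<close>.
  Membership in \<open>A\<close> is a promise about the input and need not itself be decidable.\<close>

definition decidable_on :: "'a set \<Rightarrow> ('a \<Rightarrow> nat list) \<Rightarrow> ('a \<Rightarrow> bool) \<Rightarrow> bool" where
  "decidable_on A enc Q \<longleftrightarrow>
     (\<exists>f. \<forall>x\<in>A. computes f (enc x) (if Q x then 1 else 0))"


section \<open>Signatures, instances and databases\<close>

datatype pred = Pred (pname: nat) (arity: nat)

type_synonym signature = "pred set"

datatype gterm = Const nat | Null nat

datatype 't atom = Atom (pred_of: pred) (args: "'t list")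

text \<open>As there are only countably many ground atoms, all instances are countable
  (see \<open>countable_inst\<close> below).\<close>

type_synonym inst = "gterm atom set"

instance pred :: countable by countable_datatype
instance gterm :: countable by countable_datatype
instance atom :: (countable) countable by countable_datatype

lemma countable_inst: "countable (I :: inst)"
  by (rule countableI_type)

definition atom_over :: "signature \<Rightarrow> 't atom \<Rightarrow> bool" where
  "atom_over S a \<longleftrightarrow> pred_of a \<in> S \<and> length (args a) = arity (pred_of a)"

definition instance_over :: "signature \<Rightarrow> inst \<Rightarrow> bool" where
  "instance_over S I \<longleftrightarrow> (\<forall>a\<in>I. atom_over S a)"

definition adom :: "inst \<Rightarrow> gterm set" where
  "adom I = (\<Union>a\<in>I. set_atom a)"

definition database :: "signature \<Rightarrow> inst \<Rightarrow> bool" where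
  "database S D \<longleftrightarrow> instance_over S D \<and> finite D \<and> adom D \<subseteq> range Const"

definition homomorphism :: "inst \<Rightarrow> inst \<Rightarrow> (gterm \<Rightarrow> gterm) \<Rightarrow> bool" where
  "homomorphism I J h \<longleftrightarrow>
     h ` adom I \<subseteq> adom J \<and>
     (\<forall>c. Const c \<in> adom I \<longrightarrow> h (Const c) = Const c) \<and>
     (\<forall>a\<in>I. map_atom h a \<in> J)"


section \<open>Existential rules\<close>

datatype trm = Var nat | Cst nat

primrec tvars :: "trm \<Rightarrow> nat set" where
  "tvars (Var x) = {x}"
| "tvars (Cst c) = {}"

primrec tval :: "(nat \<Rightarrow> gterm) \<Rightarrow> trm \<Rightarrow> gterm" where
  "tval v (Var x) = v x"
| "tval v (Cst c) = Const c"

definition avars :: "trm atom \<Rightarrow> nat set" where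
  "avars a = (\<Union>t\<in>set_atom a. tvars t)"

text \<open>The lists are conjunctions of atoms. Variables that occur in the head but not in the body are
  existentially quantified, all other variables are universally quantified.\<close>

datatype rule = Rule (body: "trm atom list") (head: "trm atom list")

definition body_vars :: "rule \<Rightarrow> nat set" where
  "body_vars r = (\<Union>a\<in>set (body r). avars a)"

definition head_vars :: "rule \<Rightarrow> nat set" where
  "head_vars r = (\<Union>a\<in>set (head r). avars a)"

definition rule_over :: "signature \<Rightarrow> rule \<Rightarrow> bool" where
  "rule_over S r \<longleftrightarrow> (\<forall>a\<in>set (body r) \<union> set (head r). atom_over S a)"

definition datalog_rule :: "rule \<Rightarrow> bool" where
  "datalog_rule r \<longleftrightarrow> head_vars r - body_vars r = {}"

definition sat_rule :: "inst \<Rightarrow> rule \<Rightarrow> bool" where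
  "sat_rule I r \<longleftrightarrow>
     (\<forall>v. (\<forall>a\<in>set (body r). map_atom (tval v) a \<in> I) \<longrightarrow>
       (\<exists>v'. (\<forall>x\<in>body_vars r. v' x = v x) \<and> (\<forall>a\<in>set (head r). map_atom (tval v') a \<in> I)))"

definition is_model :: "signature \<Rightarrow> inst \<Rightarrow> rule set \<Rightarrow> inst \<Rightarrow> bool" where
  "is_model S D R I \<longleftrightarrow> instance_over S I \<and> D \<subseteq> I \<and> (\<forall>r\<in>R. sat_rule I r)"

definition universal_model :: "signature \<Rightarrow> inst \<Rightarrow> rule set \<Rightarrow> inst \<Rightarrow> bool" where
  "universal_model S D R I \<longleftrightarrow>
     is_model S D R I \<and> (\<forall>J. is_model S D R J \<longrightarrow> (\<exists>h. homomorphism I J h))"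


section \<open>Datalog queries\<close>

datatype query =
  Query (edb: "pred list") (idb: "pred list") (goal: pred) (rules: "rule list")

definition datalog_query :: "signature \<Rightarrow> query \<Rightarrow> bool" where
  "datalog_query S q \<longleftrightarrow>
     set (edb q) \<subseteq> S \<and> set (idb q) \<inter> S = {} \<and>
     goal q \<in> set (idb q) \<and> arity (goal q) = 0 \<and>
     (\<forall>r\<in>set (rules q).
        datalog_rule r \<and> rule_over (set (edb q) \<union> set (idb q)) r \<and>
        (\<forall>a\<in>set (head r). pred_of a \<notin> set (edb q)))"

definition datalog_closure :: "rule set \<Rightarrow> inst \<Rightarrow> inst" where
  "datalog_closure R I = \<Inter> {J. I \<subseteq> J \<and> (\<forall>r\<in>R. sat_rule J r)}"

lemma datalog_closure_least:
  assumes "\<forall>r\<in>R. datalog_rule r"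
  shows "I \<subseteq> datalog_closure R I" "\<forall>r\<in>R. sat_rule (datalog_closure R I) r"
    "\<And>J. I \<subseteq> J \<Longrightarrow> \<forall>r\<in>R. sat_rule J r \<Longrightarrow> datalog_closure R I \<subseteq> J"
proof -
  show "I \<subseteq> datalog_closure R I" by (auto simp: datalog_closure_def)
  show least: "datalog_closure R I \<subseteq> J" if "I \<subseteq> J" "\<forall>r\<in>R. sat_rule J r" for J
    using that by (auto simp: datalog_closure_def)
  show "\<forall>r\<in>R. sat_rule (datalog_closure R I) r"
  proof
    fix r assume r: "r \<in> R"
    have *: "map_atom (tval v) a \<in> J"
      if v: "\<forall>b\<in>set (body r). map_atom (tval v) b \<in> datalog_closure R I" and a: "a \<in> set (head r)"
        and J: "I \<subseteq> J" "\<forall>r\<in>R. sat_rule J r" for v a J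
    proof -
      have "\<forall>b\<in>set (body r). map_atom (tval v) b \<in> J" using v least[OF J] by blast
      then obtain v' where v': "\<forall>x\<in>body_vars r. v' x = v x" "map_atom (tval v') a \<in> J"
        using J(2) r a unfolding sat_rule_def by blast
      have "tval v' t = tval v t" if "t \<in> set_atom a" for t
      proof (cases t)
        case (Var x)
        then have "x \<in> head_vars r" using that a by (force simp: head_vars_def avars_def)
        then have "x \<in> body_vars r" using assms r by (auto simp: datalog_rule_def)
        then show ?thesis using v'(1) Var by simp
      qed simp
      then show ?thesis using v'(2) by (metis atom.map_cong0)
    qed
    have "\<forall>a\<in>set (head r). map_atom (tval v) a \<in> datalog_closure R I"
      if "\<forall>b\<in>set (body r). map_atom (tval v) b \<in> datalog_closure R I" for v
      using *[OF that] unfolding datalog_closure_def[of R I] by blast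
    then show "sat_rule (datalog_closure R I) r"
      unfolding sat_rule_def by blast
  qed
qed

definition sat_query :: "inst \<Rightarrow> query \<Rightarrow> bool" where
  "sat_query I q \<longleftrightarrow> Atom (goal q) [] \<in> datalog_closure (set (rules q)) I"


section \<open>Monadic second-order logic\<close>

datatype mso =
    MAtom "trm atom"
  | MEq trm trm
  | MIn trm nat
  | MNot mso
  | MAnd mso mso
  | MEx nat mso
  | MExSet nat mso

primrec fo_free :: "mso \<Rightarrow> nat set" where
  "fo_free (MAtom a) = avars a"
| "fo_free (MEq s t) = tvars s \<union> tvars t"
| "fo_free (MIn t X) = tvars t"
| "fo_free (MNot p) = fo_free p"
| "fo_free (MAnd p q) = fo_free p \<union> fo_free q"
| "fo_free (MEx x p) = fo_free p - {x}"
| "fo_free (MExSet X p) = fo_free p"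

primrec so_free :: "mso \<Rightarrow> nat set" where
  "so_free (MAtom a) = {}"
| "so_free (MEq s t) = {}"
| "so_free (MIn t X) = {X}"
| "so_free (MNot p) = so_free p"
| "so_free (MAnd p q) = so_free p \<union> so_free q"
| "so_free (MEx x p) = so_free p"
| "so_free (MExSet X p) = so_free p - {X}"

primrec mso_over :: "signature \<Rightarrow> mso \<Rightarrow> bool" where
  "mso_over S (MAtom a) = atom_over S a"
| "mso_over S (MEq s t) = True"
| "mso_over S (MIn t X) = True"
| "mso_over S (MNot p) = mso_over S p"
| "mso_over S (MAnd p q) = (mso_over S p \<and> mso_over S q)"
| "mso_over S (MEx x p) = mso_over S p"
| "mso_over S (MExSet X p) = mso_over S p"

definition mso_sentence :: "signature \<Rightarrow> mso \<Rightarrow> bool" where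
  "mso_sentence S p \<longleftrightarrow> mso_over S p \<and> fo_free p = {} \<and> so_free p = {}"

text \<open>An instance is viewed as a relational structure with domain \<open>adom I\<close>. Constants denote
  themselves, also those outside the active domain.\<close>

primrec mso_sat :: "inst \<Rightarrow> (nat \<Rightarrow> gterm) \<Rightarrow> (nat \<Rightarrow> gterm set) \<Rightarrow> mso \<Rightarrow> bool" where
  "mso_sat I v V (MAtom a) \<longleftrightarrow> map_atom (tval v) a \<in> I"
| "mso_sat I v V (MEq s t) \<longleftrightarrow> tval v s = tval v t"
| "mso_sat I v V (MIn t X) \<longleftrightarrow> tval v t \<in> V X"
| "mso_sat I v V (MNot p) \<longleftrightarrow> \<not> mso_sat I v V p"
| "mso_sat I v V (MAnd p q) \<longleftrightarrow> mso_sat I v V p \<and> mso_sat I v V q"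
| "mso_sat I v V (MEx x p) \<longleftrightarrow> (\<exists>d\<in>adom I. mso_sat I (v(x := d)) V p)"
| "mso_sat I v V (MExSet X p) \<longleftrightarrow> (\<exists>A\<subseteq>adom I. mso_sat I v (V(X := A)) p)"

definition sat_mso :: "inst \<Rightarrow> mso \<Rightarrow> bool" where
  "sat_mso I p \<longleftrightarrow> (\<forall>v V. mso_sat I v V p)"

lemma mso_sat_cong:
  "\<forall>x\<in>fo_free p. v x = v' x \<Longrightarrow> \<forall>X\<in>so_free p. V X = V' X \<Longrightarrow> mso_sat I v V p = mso_sat I v' V' p"
proof (induction p arbitrary: v v' V V')
  case (MAtom a)
  have "tval v t = tval v' t" if "t \<in> set_atom a" for t
    using MAtom that by (cases t) (force simp: avars_def)+
  then have "map_atom (tval v) a = map_atom (tval v') a" by (rule atom.map_cong0)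
  then show ?case by simp
next
  case (MEq s t) then show ?case by (cases s; cases t) auto
next
  case (MIn t X) then show ?case by (cases t) auto
next
  case (MNot p) then show ?case using MNot.IH[of v v' V V'] by simp
next
  case (MAnd p q)
  have "mso_sat I v V p = mso_sat I v' V' p" using MAnd.prems by (intro MAnd.IH(1)) auto
  moreover have "mso_sat I v V q = mso_sat I v' V' q" using MAnd.prems by (intro MAnd.IH(2)) auto
  ultimately show ?case by simp
next
  case (MEx x p)
  have "mso_sat I (v(x := d)) V p = mso_sat I (v'(x := d)) V' p" for d
    using MEx.prems by (intro MEx.IH) auto
  then show ?case by simp
next
  case (MExSet X p)
  have "mso_sat I v (V(X := A)) p = mso_sat I v' (V'(X := A)) p" for A
    using MExSet.prems by (intro MExSet.IH) auto
  then show ?case by simp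
qed

lemma sat_mso_sentence: "mso_sentence S p \<Longrightarrow> sat_mso I p \<longleftrightarrow> mso_sat I v V p"
  unfolding sat_mso_def mso_sentence_def using mso_sat_cong[of p] by blast


section \<open>Datalog/MSO queries\<close>

definition damsoq :: "signature \<Rightarrow> query \<Rightarrow> mso \<Rightarrow> bool" where
  "damsoq S q p \<longleftrightarrow>
     datalog_query S q \<and> mso_sentence S p \<and>
     (\<forall>I. instance_over S I \<longrightarrow> (sat_query I q \<longleftrightarrow> sat_mso I p))"

definition entails :: "signature \<Rightarrow> inst \<Rightarrow> rule set \<Rightarrow> query \<times> mso \<Rightarrow> bool" where
  "entails S D R Q \<longleftrightarrow> (\<forall>I. is_model S D R I \<longrightarrow> sat_query I (fst Q))"

lemma entails_iff_mso:
  "damsoq S q p \<Longrightarrow> entails S D R (q, p) \<longleftrightarrow> (\<forall>I. is_model S D R I \<longrightarrow> sat_mso I p)"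
  by (auto simp: entails_def damsoq_def is_model_def)


section \<open>Encodings of inputs as natural numbers\<close>

fun enc_pred :: "pred \<Rightarrow> nat" where
  "enc_pred (Pred p k) = prod_encode (p, k)"

fun enc_gterm :: "gterm \<Rightarrow> nat" where
  "enc_gterm (Const c) = sum_encode (Inl c)"
| "enc_gterm (Null n) = sum_encode (Inr n)"

fun enc_trm :: "trm \<Rightarrow> nat" where
  "enc_trm (Var x) = sum_encode (Inl x)"
| "enc_trm (Cst c) = sum_encode (Inr c)"

fun enc_atom :: "('t \<Rightarrow> nat) \<Rightarrow> 't atom \<Rightarrow> nat" where
  "enc_atom e (Atom p ts) = prod_encode (enc_pred p, list_encode (map e ts))"

fun enc_rule :: "rule \<Rightarrow> nat" where
  "enc_rule (Rule B H) =
     prod_encode (list_encode (map (enc_atom enc_trm) B), list_encode (map (enc_atom enc_trm) H))"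

fun enc_query :: "query \<Rightarrow> nat" where
  "enc_query (Query E D g rs) =
     list_encode [list_encode (map enc_pred E), list_encode (map enc_pred D), enc_pred g,
       list_encode (map enc_rule rs)]"

definition enc_db :: "gterm atom list \<Rightarrow> nat" where
  "enc_db D = list_encode (map (enc_atom enc_gterm) D)"

fun enc_mso :: "mso \<Rightarrow> nat" where
  "enc_mso (MAtom a) = prod_encode (0, enc_atom enc_trm a)"
| "enc_mso (MEq s t) = prod_encode (1, prod_encode (enc_trm s, enc_trm t))"
| "enc_mso (MIn t X) = prod_encode (2, prod_encode (enc_trm t, X))"
| "enc_mso (MNot p) = prod_encode (3, enc_mso p)"
| "enc_mso (MAnd p q) = prod_encode (4, prod_encode (enc_mso p, enc_mso q))"
| "enc_mso (MEx x p) = prod_encode (5, prod_encode (x, enc_mso p))"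
| "enc_mso (MExSet X p) = prod_encode (6, prod_encode (X, enc_mso p))"

lemma inj_enc_pred: "inj enc_pred"
proof (rule injI)
  show "x = y" if "enc_pred x = enc_pred y" for x y
    using that by (cases x; cases y) (simp add: prod_encode_eq)
qed

lemma inj_enc_gterm: "inj enc_gterm"
proof (rule injI)
  show "x = y" if "enc_gterm x = enc_gterm y" for x y
    using that by (cases x; cases y) (simp_all add: sum_encode_eq)
qed

lemma inj_enc_trm: "inj enc_trm"
proof (rule injI)
  show "x = y" if "enc_trm x = enc_trm y" for x y
    using that by (cases x; cases y) (simp_all add: sum_encode_eq)
qed

lemma inj_enc_atom:
  assumes "inj e"
  shows "inj (enc_atom e)"
proof (rule injI)
  show "x = y" if "enc_atom e x = enc_atom e y" for x y
    using that by (cases x; cases y)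
      (simp add: prod_encode_eq list_encode_eq inj_eq[OF inj_enc_pred] inj_map_eq_map[OF assms])
qed

lemma inj_enc_rule: "inj enc_rule"
proof (rule injI)
  show "x = y" if "enc_rule x = enc_rule y" for x y
    using that by (cases x; cases y)
      (simp add: prod_encode_eq list_encode_eq inj_map_eq_map[OF inj_enc_atom[OF inj_enc_trm]])
qed

lemma inj_enc_query: "inj enc_query"
proof (rule injI)
  show "x = y" if "enc_query x = enc_query y" for x y
    using that by (cases x; cases y)
      (simp add: list_encode_eq inj_eq[OF inj_enc_pred] inj_map_eq_map[OF inj_enc_pred]
        inj_map_eq_map[OF inj_enc_rule] del: list_encode.simps)
qed

lemma inj_enc_db: "inj enc_db"
proof (rule injI)
  show "x = y" if "enc_db x = enc_db y" for x y
    using that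
    by (simp add: enc_db_def list_encode_eq inj_map_eq_map[OF inj_enc_atom[OF inj_enc_gterm]])
qed

lemma inj_enc_mso: "inj enc_mso"
proof (rule injI)
  show "p = q" if "enc_mso p = enc_mso q" for p q
    using that
  proof (induction p arbitrary: q)
    case (MAtom a) then show ?case
      by (cases q) (simp_all add: prod_encode_eq inj_eq[OF inj_enc_atom[OF inj_enc_trm]])
  next
    case (MEq s t) then show ?case
      by (cases q) (simp_all add: prod_encode_eq inj_eq[OF inj_enc_trm])
  next
    case (MIn t X) then show ?case
      by (cases q) (simp_all add: prod_encode_eq inj_eq[OF inj_enc_trm])
  qed (case_tac q; simp add: prod_encode_eq)+
qed


section \<open>Width measures\<close>

text \<open>Only the values of a width measure on instances over the given signature matter.\<close>

type_synonym width_measure = "inst \<Rightarrow> enat"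

definition mso_friendly :: "signature \<Rightarrow> width_measure \<Rightarrow> bool" where
  "mso_friendly S w \<longleftrightarrow>
     (\<exists>f. \<forall>n p. mso_sentence S p \<longrightarrow>
        ((\<nexists>I. instance_over S I \<and> sat_mso I p) \<longrightarrow> \<not> halts f [n, enc_mso p]) \<and>
        ((\<exists>I. instance_over S I \<and> sat_mso I p \<and> w I \<le> enat n) \<longrightarrow> halts f [n, enc_mso p]))"

definition finite_width_set :: "signature \<Rightarrow> width_measure \<Rightarrow> rule set \<Rightarrow> bool" where
  "finite_width_set S w R \<longleftrightarrow>
     (\<forall>D. database S D \<longrightarrow> (\<exists>I. universal_model S D R I \<and> w I \<noteq> \<infinity>))"

end

theory Submission
  imports Defs
begin

text \<open>Both answers are semidecidable. Entailment holds iff the goal atom has a finite derivation in the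
  Skolem chase of the database under the given rules together with the query rules, so one can
  enumerate derivations. If entailment fails, the query, being preserved under homomorphisms, already
  fails in a universal model of finite width; hence the MSO sentence expressing ``model of database
  and rules, but not of the query'' has a model of some width \<open>n\<close>, and the program given by
  MSO-friendliness halts on it for this \<open>n\<close>. Conversely, if that program halts for some \<open>n\<close>, the sentence
  is satisfiable and refutes entailment. Searching for either kind of witness terminates.\<close>

section \<open>Total recursive functions\<close>

text \<open>The two halves of a DaMSOQ serve the two searches. The datalog half has a positive
  least-fixpoint semantics, which gives finite derivations and preservation under homomorphisms. The
  MSO half can be negated and conjoined with a description of the models of database and rules. The
  width of a universal model is only known to be finite, not computable from the input, so it has to
  be searched for.

  The remaining work is to stay within \<open>recf\<close>. No universal machine is built: the
  program given by MSO-friendliness is fixed, and for a fixed program halting is semidecidable by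
  induction on its syntax. Semidecidability means that a total function with an extra search
  argument has a zero; it is closed under conjunction, disjunction, existential and bounded
  universal quantification. Derivations and sentences are therefore described by relations on codes
  that use only these connectives. The input is promised to be a database with a DaMSOQ, so the
  relations only have to be right on such codes.\<close>

definition total_rec :: "nat \<Rightarrow> (nat list \<Rightarrow> nat) \<Rightarrow> bool" where
  "total_rec n F \<longleftrightarrow> (\<exists>f. \<forall>xs. length xs = n \<longrightarrow> computes f xs (F xs))"

text \<open>Argument lists act as environments: recursion, sums and quantifiers push their variable
  to the front, and older variables are reached by \<open>hd\<close> and \<open>tl\<close>. Treating
  environments as vectors of functions lets one composition rule handle every change of
  environment.\<close>

definition vec_rec :: "nat \<Rightarrow> nat \<Rightarrow> (nat list \<Rightarrow> nat list) \<Rightarrow> bool" where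
  "vec_rec n m L \<longleftrightarrow>
     (\<forall>xs. length xs = n \<longrightarrow> length (L xs) = m) \<and> (\<forall>i<m. total_rec n (\<lambda>xs. L xs ! i))"

lemma total_rec_cong:
  "total_rec n F \<Longrightarrow> (\<And>xs. length xs = n \<Longrightarrow> F xs = G xs) \<Longrightarrow> total_rec n G"
  unfolding total_rec_def by metis

lemma total_rec_nth: "i < n \<Longrightarrow> total_rec n (\<lambda>xs. xs ! i)"
  unfolding total_rec_def by (intro exI[of _ "Proj i"]) (auto intro: computes.proj)

lemma vec_rec_id: "vec_rec n n (\<lambda>xs. xs)"
  by (simp add: vec_rec_def total_rec_nth)

lemma vec_rec_tl:
  assumes "vec_rec n (Suc m) L"
  shows "vec_rec n m (\<lambda>xs. tl (L xs))"
  unfolding vec_rec_def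
proof (intro conjI allI impI)
  fix i assume "i < m"
  then have "total_rec n (\<lambda>xs. L xs ! Suc i)" using assms by (simp add: vec_rec_def)
  then show "total_rec n (\<lambda>xs. tl (L xs) ! i)"
    by (rule total_rec_cong) (use assms \<open>i < m\<close> in \<open>simp add: vec_rec_def nth_tl\<close>)
qed (use assms in \<open>simp add: vec_rec_def\<close>)

lemma total_rec_hd:
  assumes "vec_rec n (Suc m) L"
  shows "total_rec n (\<lambda>xs. hd (L xs))"
proof -
  have "total_rec n (\<lambda>xs. L xs ! 0)" using assms by (simp add: vec_rec_def)
  then show ?thesis
    by (rule total_rec_cong) (use assms in \<open>auto simp: vec_rec_def length_Suc_conv\<close>)
qed

lemma vec_rec_Nil: "vec_rec n 0 (\<lambda>xs. [])"
  by (simp add: vec_rec_def)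

lemma vec_rec_Cons:
  "total_rec n A \<Longrightarrow> vec_rec n m L \<Longrightarrow> vec_rec n (Suc m) (\<lambda>xs. A xs # L xs)"
  unfolding vec_rec_def by (auto simp: less_Suc_eq_0_disj)

lemma vec_rec_map:
  "(\<And>x. x \<in> set ts \<Longrightarrow> total_rec n (\<lambda>xs. A x xs)) \<Longrightarrow> vec_rec n (length ts) (\<lambda>xs. map (\<lambda>x. A x xs) ts)"
  by (simp add: vec_rec_def)

lemma vec_rec_programs:
  assumes "vec_rec n m L"
  obtains gs where "length gs = m"
    "\<And>xs. length xs = n \<Longrightarrow> list_all2 (\<lambda>g y. computes g xs y) gs (L xs)"
proof -
  from assms obtain g where g: "\<And>i xs. i < m \<Longrightarrow> length xs = n \<Longrightarrow> computes (g i) xs (L xs ! i)"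
    unfolding vec_rec_def total_rec_def by metis
  show thesis
    by (rule that[of "map g [0..<m]"]) (use g assms in \<open>auto simp: list_all2_conv_all_nth vec_rec_def\<close>)
qed

lemma total_rec_comp:
  assumes "total_rec m F" "vec_rec n m L"
  shows "total_rec n (\<lambda>xs. F (L xs))"
proof -
  from assms(1) obtain f where f: "\<And>ys. length ys = m \<Longrightarrow> computes f ys (F ys)"
    by (auto simp: total_rec_def)
  obtain gs where gs: "\<And>xs. length xs = n \<Longrightarrow> list_all2 (\<lambda>g y. computes g xs y) gs (L xs)"
    using vec_rec_programs[OF assms(2)] by blast
  show ?thesis unfolding total_rec_def
    by (rule exI[of _ "Comp f gs"])
      (use f gs assms(2) in \<open>auto intro!: computes.comp simp: vec_rec_def\<close>)
qed

lemma vec_rec_comp: "vec_rec m k K \<Longrightarrow> vec_rec n m L \<Longrightarrow> vec_rec n k (\<lambda>xs. K (L xs))"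
  unfolding vec_rec_def[of m k] vec_rec_def[of n k]
  using total_rec_comp[of m _ n L] by (auto simp: vec_rec_def[of n m])

lemma total_rec_Suc: "total_rec n A \<Longrightarrow> total_rec n (\<lambda>xs. Suc (A xs))"
proof -
  assume A: "total_rec n A"
  have "total_rec (Suc 0) (\<lambda>xs. Suc (hd xs))"
    unfolding total_rec_def by (rule exI[of _ Succ]) (auto simp: length_Suc_conv intro: computes.succ)
  from total_rec_comp[OF this vec_rec_Cons[OF A vec_rec_Nil]] show ?thesis by simp
qed

lemma total_rec_const: "total_rec n (\<lambda>xs. c)"
proof (induction c)
  case 0 show ?case unfolding total_rec_def by (blast intro: computes.zero)
next
  case (Suc c) then show ?case by (rule total_rec_Suc)
qed

lemma total_rec_rec_nat:
  assumes "total_rec n A" "total_rec (Suc (Suc n)) (\<lambda>zs. G (hd zs) (hd (tl zs)) (tl (tl zs)))"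
    "total_rec n N"
  shows "total_rec n (\<lambda>xs. rec_nat (A xs) (\<lambda>m y. G m y xs) (N xs))"
proof -
  obtain f where f: "\<And>xs. length xs = n \<Longrightarrow> computes f xs (A xs)"
    using assms(1) by (auto simp: total_rec_def)
  obtain g where "\<And>zs. length zs = Suc (Suc n) \<Longrightarrow> computes g zs (G (hd zs) (hd (tl zs)) (tl (tl zs)))"
    using assms(2) by (auto simp: total_rec_def)
  from this[of "_ # _ # _"]
  have g: "\<And>m y xs. length xs = n \<Longrightarrow> computes g (m # y # xs) (G m y xs)" by simp
  have "computes (Prec f g) (k # xs) (rec_nat (A xs) (\<lambda>m y. G m y xs) k)" if "length xs = n" for k xs
    by (induction k) (auto intro: computes.intros f g that)
  then have "total_rec (Suc n) (\<lambda>zs. rec_nat (A (tl zs)) (\<lambda>m y. G m y (tl zs)) (hd zs))"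
    unfolding total_rec_def by (intro exI[of _ "Prec f g"]) (auto simp: length_Suc_conv)
  \<comment> \<open>Precomposition with \<open>N xs # xs\<close> turns the recursion variable into
    an arbitrary term while keeping \<open>xs\<close> as parameters.\<close>
  from total_rec_comp[OF this vec_rec_Cons[OF assms(3) vec_rec_id]] show ?thesis by simp
qed

lemma total_rec_comp1:
  assumes "total_rec (Suc 0) (\<lambda>zs. h (hd zs))" "total_rec n A"
  shows "total_rec n (\<lambda>xs. h (A xs))"
  using total_rec_comp[OF assms(1) vec_rec_Cons[OF assms(2) vec_rec_Nil]] by simp

lemma total_rec_comp2:
  assumes "total_rec (Suc (Suc 0)) (\<lambda>zs. h (hd zs) (hd (tl zs)))" "total_rec n A" "total_rec n B"
  shows "total_rec n (\<lambda>xs. h (A xs) (B xs))"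
  using total_rec_comp[OF assms(1) vec_rec_Cons[OF assms(2) vec_rec_Cons[OF assms(3) vec_rec_Nil]]]
  by simp

text \<open>These closure rules are directed by the outermost operator, so that
  \<open>(rule trec)+\<close> certifies a term or formula by parsing it.\<close>

named_theorems trec

lemmas [trec] = vec_rec_id vec_rec_tl total_rec_hd vec_rec_Nil vec_rec_Cons total_rec_Suc total_rec_const
  total_rec_rec_nat

section \<open>Arithmetic, bounded sums and bounded products\<close>

lemma total_rec_add [trec]: "total_rec n A \<Longrightarrow> total_rec n B \<Longrightarrow> total_rec n (\<lambda>xs. A xs + B xs)"
proof (rule total_rec_comp2[where h = "(+)"])
  have "rec_nat b (\<lambda>_. Suc) a = a + b" for a b by (induction a) auto
  moreover have "total_rec (Suc (Suc 0)) (\<lambda>zs. rec_nat (hd (tl zs)) (\<lambda>_ y. Suc y) (hd zs))"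
    by (rule trec)+
  ultimately show "total_rec (Suc (Suc 0)) (\<lambda>zs. hd zs + hd (tl zs))" by simp
qed

lemma total_rec_mult [trec]: "total_rec n A \<Longrightarrow> total_rec n B \<Longrightarrow> total_rec n (\<lambda>xs. A xs * B xs)"
proof (rule total_rec_comp2[where h = "(*)"])
  have "rec_nat 0 (\<lambda>_ y. b + y) a = a * b" for a b :: nat by (induction a) auto
  moreover have "total_rec (Suc (Suc 0)) (\<lambda>zs. rec_nat 0 (\<lambda>_ y. hd (tl zs) + y) (hd zs))"
    by (rule trec)+
  ultimately show "total_rec (Suc (Suc 0)) (\<lambda>zs. hd zs * hd (tl zs))" by simp
qed

lemma total_rec_pred: "total_rec n A \<Longrightarrow> total_rec n (\<lambda>xs. A xs - 1)"
proof (rule total_rec_comp1[where h = "\<lambda>a. a - 1"])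
  have "rec_nat 0 (\<lambda>m _. m) a = a - 1" for a :: nat by (induction a) auto
  moreover have "total_rec (Suc 0) (\<lambda>zs. rec_nat 0 (\<lambda>m _. m) (hd zs))"
    by (rule trec)+
  ultimately show "total_rec (Suc 0) (\<lambda>zs. hd zs - 1)" by simp
qed

lemma total_rec_diff [trec]: "total_rec n A \<Longrightarrow> total_rec n B \<Longrightarrow> total_rec n (\<lambda>xs. A xs - B xs)"
proof (rule total_rec_comp2[where h = "(-)"])
  have "rec_nat a (\<lambda>_ y. y - 1) b = a - b" for a b :: nat by (induction b) auto
  moreover have "total_rec (Suc (Suc 0)) (\<lambda>zs. rec_nat (hd zs) (\<lambda>_ y. y - 1) (hd (tl zs)))"
    by (rule trec total_rec_pred)+
  ultimately show "total_rec (Suc (Suc 0)) (\<lambda>zs. hd zs - hd (tl zs))" by simp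
qed

lemma total_rec_fold_less:
  assumes "total_rec (Suc n) (\<lambda>zs. F (hd zs) (tl zs))" "total_rec n N"
    and "total_rec (Suc (Suc 0)) (\<lambda>zs. h (hd zs) (hd (tl zs)))"
  shows "total_rec n (\<lambda>xs. rec_nat c (\<lambda>m y. h y (F m xs)) (N xs))"
proof (rule total_rec_rec_nat)
  \<comment> \<open>Inside the recursion the accumulator sits between the index and the parameters;
    this vector removes it before \<open>F\<close> is applied.\<close>
  have "vec_rec (Suc (Suc n)) (Suc n) (\<lambda>zs. hd zs # tl (tl zs))"
    by (rule trec)+
  from total_rec_comp[OF assms(1) this]
  have F: "total_rec (Suc (Suc n)) (\<lambda>zs. F (hd zs) (tl (tl zs)))" by simp
  have "total_rec (Suc (Suc n)) (\<lambda>zs. hd (tl zs))" by (rule trec)+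
  then show "total_rec (Suc (Suc n)) (\<lambda>zs. h (hd (tl zs)) (F (hd zs) (tl (tl zs))))"
    by (rule total_rec_comp2[OF assms(3) _ F])
qed (rule total_rec_const assms)+

lemma total_rec_sum [trec]:
  assumes "total_rec (Suc n) (\<lambda>zs. F (hd zs) (tl zs))" "total_rec n N"
  shows "total_rec n (\<lambda>xs. \<Sum>i<N xs. F i xs)"
proof -
  have "rec_nat 0 (\<lambda>m y. y + F m xs) k = (\<Sum>i<k. F i xs)" for xs k
    by (induction k) auto
  moreover have "total_rec (Suc (Suc 0)) (\<lambda>zs. hd zs + hd (tl zs))" by (rule trec)+
  ultimately show ?thesis using total_rec_fold_less[OF assms, where h = "(+)" and c = 0] by simp
qed

lemma total_rec_prod [trec]:
  assumes "total_rec (Suc n) (\<lambda>zs. F (hd zs) (tl zs))" "total_rec n N"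
  shows "total_rec n (\<lambda>xs. \<Prod>i<N xs. F i xs)"
proof -
  have "rec_nat 1 (\<lambda>m y. y * F m xs) k = (\<Prod>i<k. F i xs)" for xs k
    by (induction k) auto
  moreover have "total_rec (Suc (Suc 0)) (\<lambda>zs. hd zs * hd (tl zs))" by (rule trec)+
  ultimately show ?thesis using total_rec_fold_less[OF assms, where h = "(*)" and c = 1] by simp
qed

section \<open>Pairs and lists\<close>

definition pfst :: "nat \<Rightarrow> nat" where "pfst z = fst (prod_decode z)"
definition psnd :: "nat \<Rightarrow> nat" where "psnd z = snd (prod_decode z)"
definition pair :: "nat \<Rightarrow> nat \<Rightarrow> nat" where "pair x y = prod_encode (x, y)"
text \<open>\<open>list_encode\<close> sends the empty list to 0 and a nonempty one to the successor
  of a pair, whence the \<open>- 1\<close>. As \<open>ctl 0 = 0\<close>, reading past the end yields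
  0.\<close>

definition ctl :: "nat \<Rightarrow> nat" where "ctl l = psnd (l - 1)"
definition cdrop :: "nat \<Rightarrow> nat \<Rightarrow> nat" where "cdrop i l = rec_nat l (\<lambda>_. ctl) i"
definition cnth :: "nat \<Rightarrow> nat \<Rightarrow> nat" where "cnth l i = pfst (cdrop i l - 1)"
text \<open>\<open>1 - (1 - n)\<close> is the sign of \<open>n\<close>, so the sum counts the
  nonempty suffixes. The code \<open>l\<close> is a large enough bound because it is at least the
  length.\<close>

definition clen :: "nat \<Rightarrow> nat" where "clen l = (\<Sum>i<l. 1 - (1 - cdrop i l))"

lemma pair_simps [simp]: "pfst (pair x y) = x" "psnd (pair x y) = y" "pair (pfst z) (psnd z) = z"
  by (simp_all add: pfst_def psnd_def pair_def)

lemma pair_eq_iff [simp]: "pair x y = pair x' y' \<longleftrightarrow> x = x' \<and> y = y'"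
  by (simp add: pair_def prod_encode_eq)

lemma pair_ge: "x \<le> pair x y" "y \<le> pair x y"
  by (simp_all add: pair_def le_prod_encode_1 le_prod_encode_2)

lemma pfst_0 [simp]: "pfst 0 = 0" and psnd_0 [simp]: "psnd 0 = 0"
proof -
  have "pair 0 0 = 0" by (simp add: pair_def prod_encode_def)
  then show "pfst 0 = 0" "psnd 0 = 0" using pair_simps(1,2)[of 0 0] by simp_all
qed

lemma ctl_list_encode: "ctl (list_encode xs) = list_encode (tl xs)"
  by (cases xs) (simp_all add: ctl_def, simp add: psnd_def)

lemma cdrop_list_encode: "cdrop i (list_encode xs) = list_encode (drop i xs)"
  by (induction i) (auto simp: cdrop_def ctl_list_encode drop_Suc tl_drop)

lemma list_encode_eq_0 [simp]: "list_encode xs = 0 \<longleftrightarrow> xs = []"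
  by (cases xs) auto

lemma cnth_list_encode [simp]: "cnth (list_encode xs) i = (if i < length xs then xs ! i else 0)"
proof (cases "i < length xs")
  case True
  then show ?thesis
    by (simp add: cnth_def cdrop_list_encode Cons_nth_drop_Suc[symmetric] pfst_def)
next
  case False
  then show ?thesis by (simp add: cnth_def cdrop_list_encode)
qed

lemma length_le_list_encode: "length xs \<le> list_encode xs"
proof (induction xs)
  case (Cons x xs)
  have "list_encode xs \<le> prod_encode (x, list_encode xs)" by (rule le_prod_encode_2)
  with Cons show ?case by simp
qed simp

lemma clen_list_encode [simp]: "clen (list_encode xs) = length xs"
proof -
  have "clen (list_encode xs) = (\<Sum>i<list_encode xs. if i < length xs then 1 else 0)"
    unfolding clen_def cdrop_list_encode
  proof (rule sum.cong)
    fix i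
    show "1 - (1 - list_encode (drop i xs)) = (if i < length xs then 1 else 0)"
    proof (cases "i < length xs")
      case True
      then have "list_encode (drop i xs) > 0" by (simp flip: neq0_conv)
      then show ?thesis using True by simp
    qed simp
  qed simp
  also have "\<dots> = (\<Sum>i<length xs. 1)"
    using length_le_list_encode[of xs]
    by (intro sum.mono_neutral_cong_right) auto
  finally show ?thesis by simp
qed

lemma total_rec_pair [trec]: "total_rec n A \<Longrightarrow> total_rec n B \<Longrightarrow> total_rec n (\<lambda>xs. pair (A xs) (B xs))"
proof (rule total_rec_comp2[where h = pair])
  have eq: "pair x y = (\<Sum>i<Suc (x + y). i) + x" for x y
  proof -
    have "triangle k = (\<Sum>i<Suc k. i)" for k
      by (induction k) simp_all
    then show ?thesis by (simp add: pair_def prod_encode_def)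
  qed
  show "total_rec (Suc (Suc 0)) (\<lambda>zs. pair (hd zs) (hd (tl zs)))"
    unfolding eq by (rule trec)+
qed

definition eqind :: "nat \<Rightarrow> nat \<Rightarrow> nat" where "eqind a b = 1 - ((a - b) + (b - a))"

lemma eqind_eq: "eqind a b = (if a = b then 1 else 0)"
  by (auto simp: eqind_def)

text \<open>Inversion of the pairing by bounded search: exactly one pair with components at most
  \<open>z\<close> has code \<open>z\<close>, so a sum weighted by the equality indicator has a
  single relevant term.\<close>

lemma total_rec_pfst [trec]: "total_rec n A \<Longrightarrow> total_rec n (\<lambda>xs. pfst (A xs))"
proof (rule total_rec_comp1[where h = pfst])
  have eq: "pfst z = (\<Sum>x<Suc z. \<Sum>y<Suc z. x * eqind (pair x y) z)" for z
  proof -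
    have "(\<Sum>x<Suc z. \<Sum>y<Suc z. x * eqind (pair x y) z)
      = (\<Sum>x<Suc z. \<Sum>y<Suc z. if x = pfst z \<and> y = psnd z then x else 0)"
      by (intro sum.cong refl) (metis eqind_eq mult.right_neutral mult_0_right pair_simps)
    also have "\<dots> = (\<Sum>x<Suc z. if x = pfst z then x else 0)"
    proof (intro sum.cong refl)
      fix x
      have "psnd z < Suc z" using pair_ge(2)[of "psnd z" "pfst z"] by simp
      then show "(\<Sum>y<Suc z. if x = pfst z \<and> y = psnd z then x else 0) = (if x = pfst z then x else 0)"
        by (cases "x = pfst z") (auto simp: sum.delta simp del: sum.lessThan_Suc)
    qed
    also have "\<dots> = pfst z"
    proof -
      have "pfst z < Suc z" using pair_ge(1)[of "pfst z" "psnd z"] by simp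
      then show ?thesis by (auto simp: sum.delta simp del: sum.lessThan_Suc)
    qed
    finally show ?thesis ..
  qed
  show "total_rec (Suc 0) (\<lambda>zs. pfst (hd zs))"
    unfolding eq eqind_def by (rule trec)+
qed

lemma total_rec_psnd [trec]: "total_rec n A \<Longrightarrow> total_rec n (\<lambda>xs. psnd (A xs))"
proof (rule total_rec_comp1[where h = psnd])
  have eq: "psnd z = (\<Sum>y<Suc z. y * eqind (pair (pfst z) y) z)" for z
  proof -
    have "(\<Sum>y<Suc z. y * eqind (pair (pfst z) y) z) = (\<Sum>y<Suc z. if y = psnd z then y else 0)"
      by (intro sum.cong refl) (metis eqind_eq mult.right_neutral mult_0_right pair_simps)
    also have "\<dots> = psnd z"
    proof -
      have "psnd z < Suc z" using pair_ge(2)[of "psnd z" "pfst z"] by simp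
      then show ?thesis by (auto simp: sum.delta simp del: sum.lessThan_Suc)
    qed
    finally show ?thesis ..
  qed
  show "total_rec (Suc 0) (\<lambda>zs. psnd (hd zs))"
    unfolding eq eqind_def by (rule trec)+
qed

lemma total_rec_ctl: "total_rec n A \<Longrightarrow> total_rec n (\<lambda>xs. ctl (A xs))"
  by (rule total_rec_comp1[where h = ctl]) (simp only: ctl_def, (rule trec)+)

lemma total_rec_cdrop [trec]: "total_rec n A \<Longrightarrow> total_rec n B \<Longrightarrow> total_rec n (\<lambda>xs. cdrop (A xs) (B xs))"
  by (rule total_rec_comp2[where h = cdrop]) (simp only: cdrop_def, (rule trec total_rec_ctl)+)

lemma total_rec_cnth [trec]: "total_rec n A \<Longrightarrow> total_rec n B \<Longrightarrow> total_rec n (\<lambda>xs. cnth (A xs) (B xs))"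
  by (rule total_rec_comp2[where h = cnth]) (simp only: cnth_def, (rule trec)+)

lemma total_rec_clen [trec]: "total_rec n A \<Longrightarrow> total_rec n (\<lambda>xs. clen (A xs))"
  by (rule total_rec_comp1[where h = clen]) (simp only: clen_def, (rule trec)+)

section \<open>Semidecidable relations\<close>

text \<open>Success is the value 0, as in \<open>Mini\<close>; thus products express disjunction and
  sums conjunction.\<close>

definition semidec :: "nat \<Rightarrow> (nat list \<Rightarrow> bool) \<Rightarrow> bool" where
  "semidec n P \<longleftrightarrow>
     (\<exists>G. total_rec (Suc n) G \<and> (\<forall>xs. length xs = n \<longrightarrow> P xs = (\<exists>k. G (k # xs) = 0)))"

text \<open>Multiplying the values at all stages up to \<open>k\<close> makes success permanent.
  Conjunction and the quantifiers need this to merge several searches at one common stage.\<close>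

lemma semidec_monotone_witness:
  assumes "semidec n P"
  obtains G where "total_rec (Suc n) G" "\<And>xs. length xs = n \<Longrightarrow> P xs = (\<exists>k. G (k # xs) = 0)"
    "\<And>xs j k. length xs = n \<Longrightarrow> G (j # xs) = 0 \<Longrightarrow> j \<le> k \<Longrightarrow> G (k # xs) = 0"
proof -
  obtain G where G: "total_rec (Suc n) G" "\<And>xs. length xs = n \<Longrightarrow> P xs = (\<exists>k. G (k # xs) = 0)"
    using assms unfolding semidec_def by blast
  define H where "H = (\<lambda>zs. \<Prod>j<Suc (hd zs). G (j # tl zs))"
  have "vec_rec (Suc (Suc n)) (Suc n) (\<lambda>zs. hd zs # tl (tl zs))" by (rule trec)+
  note G' = total_rec_comp[OF G(1) this]
  have "total_rec (Suc n) H" unfolding H_def by (rule trec G')+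
  moreover have "H (k # xs) = 0 \<longleftrightarrow> (\<exists>j\<le>k. G (j # xs) = 0)" for k xs
    by (auto simp: H_def less_Suc_eq_le prod_zero_iff simp del: prod.lessThan_Suc)
  ultimately show thesis using G(2) by (intro that[of H]) (auto intro: order_trans)
qed

lemma semidec_cong: "semidec n P \<Longrightarrow> (\<And>xs. length xs = n \<Longrightarrow> P xs = Q xs) \<Longrightarrow> semidec n Q"
  unfolding semidec_def by auto

lemma semidec_comp:
  assumes "semidec m P" "vec_rec n m L"
  shows "semidec n (\<lambda>xs. P (L xs))"
proof -
  obtain G where G: "total_rec (Suc m) G" "\<And>xs. length xs = m \<Longrightarrow> P xs = (\<exists>k. G (k # xs) = 0)"
    using assms unfolding semidec_def by blast
  have "vec_rec (Suc n) (Suc m) (\<lambda>zs. hd zs # L (tl zs))"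
    by (rule vec_rec_Cons vec_rec_comp[OF assms(2)] trec)+
  from total_rec_comp[OF G(1) this] G(2) assms(2) show ?thesis
    unfolding semidec_def vec_rec_def
    by (intro exI[of _ "\<lambda>zs. G (hd zs # L (tl zs))"]) auto
qed

lemma semidec_eq_0: 
  assumes "total_rec n A"
  shows "semidec n (\<lambda>xs. A xs = 0)"
proof -
  have "vec_rec (Suc n) n (\<lambda>zs. tl zs)" by (rule trec)+
  from total_rec_comp[OF assms this] show ?thesis
    unfolding semidec_def by (intro exI[of _ "\<lambda>zs. A (tl zs)"]) auto
qed

lemma semidec_eq [trec]: "total_rec n A \<Longrightarrow> total_rec n B \<Longrightarrow> semidec n (\<lambda>xs. A xs = B xs)"
  by (rule semidec_cong[OF semidec_eq_0[of n "\<lambda>xs. (A xs - B xs) + (B xs - A xs)"]]) (rule trec | auto)+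

lemma semidec_less [trec]: "total_rec n A \<Longrightarrow> total_rec n B \<Longrightarrow> semidec n (\<lambda>xs. A xs < B xs)"
  by (rule semidec_cong[OF semidec_eq_0[of n "\<lambda>xs. Suc (A xs) - B xs"]]) (rule trec | auto)+

lemma semidec_disj [trec]:
  assumes "semidec n P" "semidec n Q"
  shows "semidec n (\<lambda>xs. P xs \<or> Q xs)"
proof -
  obtain G H where "total_rec (Suc n) G" "\<And>xs. length xs = n \<Longrightarrow> P xs = (\<exists>k. G (k # xs) = 0)"
    "total_rec (Suc n) H" "\<And>xs. length xs = n \<Longrightarrow> Q xs = (\<exists>k. H (k # xs) = 0)"
    using assms unfolding semidec_def by blast
  then show ?thesis unfolding semidec_def
    by (intro exI[of _ "\<lambda>zs. G zs * H zs"]) (auto intro: trec)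
qed

text \<open>There is no closure under negation, so inequality gets its own rule, through the two
  strict orders.\<close>

lemma semidec_neq [trec]: "total_rec n A \<Longrightarrow> total_rec n B \<Longrightarrow> semidec n (\<lambda>xs. A xs \<noteq> B xs)"
  unfolding nat_neq_iff by (intro trec)

lemma semidec_conj [trec]:
  assumes "semidec n P" "semidec n Q"
  shows "semidec n (\<lambda>xs. P xs \<and> Q xs)"
proof -
  obtain G where G: "total_rec (Suc n) G" "\<And>xs. length xs = n \<Longrightarrow> P xs = (\<exists>k. G (k # xs) = 0)"
    "\<And>xs j k. length xs = n \<Longrightarrow> G (j # xs) = 0 \<Longrightarrow> j \<le> k \<Longrightarrow> G (k # xs) = 0"
    using semidec_monotone_witness[OF assms(1)] by blast
  obtain H where H: "total_rec (Suc n) H" "\<And>xs. length xs = n \<Longrightarrow> Q xs = (\<exists>k. H (k # xs) = 0)"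
    "\<And>xs j k. length xs = n \<Longrightarrow> H (j # xs) = 0 \<Longrightarrow> j \<le> k \<Longrightarrow> H (k # xs) = 0"
    using semidec_monotone_witness[OF assms(2)] by blast
  have "P xs \<and> Q xs \<longleftrightarrow> (\<exists>k. G (k # xs) + H (k # xs) = 0)" if xs: "length xs = n" for xs
  proof
    assume "P xs \<and> Q xs"
    then obtain j k where "G (j # xs) = 0" "H (k # xs) = 0" using G(2)[OF xs] H(2)[OF xs] by metis
    then have "G (max j k # xs) = 0" "H (max j k # xs) = 0"
      using G(3)[OF xs] H(3)[OF xs] by (meson max.cobounded1 max.cobounded2)+
    then show "\<exists>k. G (k # xs) + H (k # xs) = 0" by auto
  qed (use G(2) H(2) that in auto)
  moreover have "total_rec (Suc n) (\<lambda>zs. G zs + H zs)" by (rule trec G(1) H(1))+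
  ultimately show ?thesis unfolding semidec_def by blast
qed

text \<open>One number \<open>k\<close> bounds both the witness \<open>y\<close> and the stage of
  the search for it; monotonicity makes a stage above both available.\<close>

lemma semidec_ex [trec]:
  assumes "semidec (Suc n) (\<lambda>zs. P (hd zs) (tl zs))"
  shows "semidec n (\<lambda>xs. \<exists>y. P y xs)"
proof -
  obtain G where G: "total_rec (Suc (Suc n)) G"
    "\<And>zs. length zs = Suc n \<Longrightarrow> P (hd zs) (tl zs) = (\<exists>k. G (k # zs) = 0)"
    "\<And>zs j k. length zs = Suc n \<Longrightarrow> G (j # zs) = 0 \<Longrightarrow> j \<le> k \<Longrightarrow> G (k # zs) = 0"
    using semidec_monotone_witness[OF assms] by blast
  have P: "P y xs = (\<exists>k. G (k # y # xs) = 0)" if "length xs = n" for y xs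
    using G(2)[of "y # xs"] that by simp
  define H where "H = (\<lambda>zs. \<Prod>y<Suc (hd zs). G (hd zs # y # tl zs))"
  \<comment> \<open>The product puts \<open>y\<close> in front of the stage, whereas
    \<open>G\<close> expects the stage first.\<close>
  have "vec_rec (Suc (Suc n)) (Suc (Suc n)) (\<lambda>zs. hd (tl zs) # hd zs # tl (tl zs))" by (rule trec)+
  note G' = total_rec_comp[OF G(1) this]
  have "total_rec (Suc n) H" unfolding H_def by (rule trec G')+
  moreover have H: "H (k # xs) = 0 \<longleftrightarrow> (\<exists>y\<le>k. G (k # y # xs) = 0)" for k xs
    by (auto simp: H_def less_Suc_eq_le prod_zero_iff simp del: prod.lessThan_Suc)
  have "(\<exists>y. P y xs) \<longleftrightarrow> (\<exists>k. H (k # xs) = 0)" if xs: "length xs = n" for xs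
  proof
    assume "\<exists>y. P y xs"
    then obtain y k where "G (k # y # xs) = 0" using P[OF xs] by metis
    then have "G (max k y # y # xs) = 0" using G(3)[of "y # xs" k "max k y"] xs by simp
    then show "\<exists>k. H (k # xs) = 0" unfolding H by (meson max.cobounded2)
  qed (use P xs in \<open>auto simp: H\<close>)
  ultimately show ?thesis unfolding semidec_def by blast
qed

text \<open>Finitely many searches that succeed have a largest stage, and by monotonicity all of
  them have succeeded there.\<close>

lemma semidec_all_less [trec]:
  assumes "semidec (Suc n) (\<lambda>zs. P (hd zs) (tl zs))" "total_rec n N"
  shows "semidec n (\<lambda>xs. \<forall>i<N xs. P i xs)"
proof -
  obtain G where G: "total_rec (Suc (Suc n)) G"
    "\<And>zs. length zs = Suc n \<Longrightarrow> P (hd zs) (tl zs) = (\<exists>k. G (k # zs) = 0)"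
    "\<And>zs j k. length zs = Suc n \<Longrightarrow> G (j # zs) = 0 \<Longrightarrow> j \<le> k \<Longrightarrow> G (k # zs) = 0"
    using semidec_monotone_witness[OF assms(1)] by blast
  have P: "P y xs = (\<exists>k. G (k # y # xs) = 0)" if "length xs = n" for y xs
    using G(2)[of "y # xs"] that by simp
  define H where "H = (\<lambda>zs. \<Sum>i<N (tl zs). G (hd zs # i # tl zs))"
  have "vec_rec (Suc (Suc n)) (Suc (Suc n)) (\<lambda>zs. hd (tl zs) # hd zs # tl (tl zs))" by (rule trec)+
  note G' = total_rec_comp[OF G(1) this]
  have "vec_rec (Suc n) n (\<lambda>zs. tl zs)" by (rule trec)+
  note N' = total_rec_comp[OF assms(2) this]
  have "total_rec (Suc n) H" unfolding H_def using G' N' by (intro total_rec_sum) simp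
  moreover have H: "H (k # xs) = 0 \<longleftrightarrow> (\<forall>i<N xs. G (k # i # xs) = 0)" for k xs
    by (auto simp: H_def)
  have "(\<forall>i<N xs. P i xs) \<longleftrightarrow> (\<exists>k. H (k # xs) = 0)" if xs: "length xs = n" for xs
  proof
    assume "\<forall>i<N xs. P i xs"
    then obtain k where k: "\<forall>i<N xs. G (k i # i # xs) = 0" using P[OF xs] by metis
    have "G (Max (k ` {..<N xs}) # i # xs) = 0" if "i < N xs" for i
      using G(3)[of "i # xs" "k i"] k that xs by (simp add: Max_ge)
    then show "\<exists>k. H (k # xs) = 0" unfolding H by blast
  qed (use P xs in \<open>auto simp: H\<close>)
  ultimately show ?thesis unfolding semidec_def by blast
qed

text \<open>A run of a primitive recursion is witnessed by the code of the list of its intermediate values, so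
  computation steps need not be counted.\<close>

lemma semidec_computes: "semidec (Suc n) (\<lambda>zs. computes f (tl zs) (hd zs))"
proof (induction f arbitrary: n)
  case Zero
  have "semidec (Suc n) (\<lambda>zs. hd zs = 0)" by (rule trec)+
  then show ?case by (rule semidec_cong) (auto intro: computes.intros elim: computesE)
next
  case Succ
  show ?case
  proof (cases "n = 1")
    case True
    have "semidec (Suc (Suc 0)) (\<lambda>zs. hd zs = Suc (hd (tl zs)))" by (rule trec)+
    then have "semidec (Suc n) (\<lambda>zs. hd zs = Suc (hd (tl zs)))" using True by simp
    then show ?thesis
      by (rule semidec_cong) (use True in \<open>auto simp: length_Suc_conv intro: computes.intros elim: computesE\<close>)
  next
    case False
    have "semidec (Suc n) (\<lambda>zs. 1 = (0::nat))" by (rule trec)+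
    then show ?thesis
      by (rule semidec_cong) (use False in \<open>auto simp: length_Suc_conv elim: computesE\<close>)
  qed
next
  case (Proj i)
  show ?case
  proof (cases "i < n")
    case True
    have "semidec (Suc n) (\<lambda>zs. hd zs = zs ! Suc i)"
      by (rule trec total_rec_nth)+ (use True in auto)
    then show ?thesis
      by (rule semidec_cong) (use True in \<open>auto simp: length_Suc_conv intro: computes.intros elim: computesE\<close>)
  next
    case False
    have "semidec (Suc n) (\<lambda>zs. 1 = (0::nat))" by (rule trec)+
    then show ?thesis
      by (rule semidec_cong) (use False in \<open>auto simp: length_Suc_conv elim: computesE\<close>)
  qed
next
  case (Comp f gs)
  define m where "m = length gs"
  have *: "semidec (Suc (Suc n)) (\<lambda>zs. computes (gs ! j) (tl (tl zs)) (cnth (hd zs) j))" if "j < m" for j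
  proof -
    have "gs ! j \<in> set gs" using that by (simp add: m_def)
    note Comp.IH(2)[OF this, of n]
    moreover have "vec_rec (Suc (Suc n)) (Suc n) (\<lambda>zs. cnth (hd zs) j # tl (tl zs))" by (rule trec)+
    ultimately show ?thesis using semidec_comp by fastforce
  qed
  \<comment> \<open>The program \<open>gs ! j\<close> changes with \<open>j\<close>, so this is a
    fixed finite conjunction and no instance of \<open>semidec_all_less\<close>; it is built up by
    induction on the number of conjuncts.\<close>
  have all: "semidec (Suc (Suc n)) (\<lambda>zs. \<forall>j<k. computes (gs ! j) (tl (tl zs)) (cnth (hd zs) j))" if "k \<le> m" for k
    using that
  proof (induction k)
    case 0
    have "semidec (Suc (Suc n)) (\<lambda>zs. 0 = (0::nat))" by (rule trec)+
    then show ?case by simp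
  next
    case (Suc k)
    then have "semidec (Suc (Suc n)) (\<lambda>zs. computes (gs ! k) (tl (tl zs)) (cnth (hd zs) k) \<and>
      (\<forall>j<k. computes (gs ! j) (tl (tl zs)) (cnth (hd zs) j)))"
      by (intro semidec_conj *) auto
    then show ?case by (rule semidec_cong) (auto simp: less_Suc_eq)
  qed
  have "total_rec (Suc (Suc n)) (\<lambda>zs. cnth (hd zs) j)" for j by (rule trec)+
  from vec_rec_map[of "[0..<m]", OF this]
  have "vec_rec (Suc (Suc n)) m (\<lambda>zs. map (\<lambda>j. cnth (hd zs) j) [0..<m])" by simp
  then have "vec_rec (Suc (Suc n)) (Suc m) (\<lambda>zs. hd (tl zs) # map (\<lambda>j. cnth (hd zs) j) [0..<m])"
    by (rule vec_rec_Cons[rotated]) (rule trec)+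
  from semidec_comp[OF Comp.IH(1) this]
  have "semidec (Suc (Suc n)) (\<lambda>zs. computes f (map (\<lambda>j. cnth (hd zs) j) [0..<m]) (hd (tl zs)))" by simp
  with all[of m] have "semidec (Suc n) (\<lambda>zs. \<exists>c. (\<forall>j<m. computes (gs ! j) (tl zs) (cnth c j)) \<and>
    computes f (map (\<lambda>j. cnth c j) [0..<m]) (hd zs))"
    by (intro semidec_ex semidec_conj) auto
  then show ?case
  proof (rule semidec_cong)
    fix zs :: "nat list"
    show "(\<exists>c. (\<forall>j<m. computes (gs ! j) (tl zs) (cnth c j)) \<and>
      computes f (map (\<lambda>j. cnth c j) [0..<m]) (hd zs)) \<longleftrightarrow> computes (Comp f gs) (tl zs) (hd zs)" (is "?L \<longleftrightarrow> ?R")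
    proof
      assume ?L
      then show ?R by (auto intro!: computes.comp simp: list_all2_conv_all_nth m_def)
    next
      assume ?R
      then obtain ys where ys: "list_all2 (\<lambda>g y. computes g (tl zs) y) gs ys" "computes f ys (hd zs)"
        by (rule computesE(4))
      then have "length ys = m" by (simp add: m_def list_all2_lengthD)
      then have "map (\<lambda>j. cnth (list_encode ys) j) [0..<m] = ys"
        by (intro nth_equalityI) auto
      then show ?L using ys \<open>length ys = m\<close>
        by (intro exI[of _ "list_encode ys"]) (auto simp: list_all2_conv_all_nth)
    qed
  qed
next
  case (Prec f g)
  show ?case
  proof (cases n)
    case 0
    have "semidec (Suc n) (\<lambda>zs. 1 = (0::nat))" by (rule trec)+
    then show ?thesis
      by (rule semidec_cong) (use 0 in \<open>auto simp: length_Suc_conv elim: computes.cases\<close>)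
  next
    case (Suc k)
    \<comment> \<open>The environment is the code of the value list, the result, the recursion
      counter and the parameters; below, the index of the bounded quantifier is added in
      front.\<close>
    have f: "semidec (Suc (Suc n)) (\<lambda>zs. computes f (tl (tl (tl zs))) (cnth (hd zs) 0))"
    proof -
      have "vec_rec (Suc (Suc n)) (Suc k) (\<lambda>zs. cnth (hd zs) 0 # tl (tl (tl zs)))"
        unfolding Suc by (rule trec)+
      from semidec_comp[OF Prec.IH(1) this] show ?thesis by simp
    qed
    have g: "semidec (Suc (Suc (Suc n))) (\<lambda>zs. computes g (hd zs # cnth (hd (tl zs)) (hd zs) # tl (tl (tl (tl zs))))
      (cnth (hd (tl zs)) (Suc (hd zs))))"
    proof -
      have "vec_rec (Suc (Suc (Suc n))) (Suc (Suc (Suc k)))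
        (\<lambda>zs. cnth (hd (tl zs)) (Suc (hd zs)) # hd zs # cnth (hd (tl zs)) (hd zs) # tl (tl (tl (tl zs))))"
        unfolding Suc by (rule trec)+
      from semidec_comp[OF Prec.IH(2) this] show ?thesis by simp
    qed
    have "semidec (Suc n) (\<lambda>zs. \<exists>c. hd zs = cnth c (hd (tl zs)) \<and> computes f (tl (tl zs)) (cnth c 0) \<and>
      (\<forall>j<hd (tl zs). computes g (j # cnth c j # tl (tl zs)) (cnth c (Suc j))))"
      unfolding Suc by (rule f[unfolded Suc] g[unfolded Suc] trec)+
    then show ?thesis
    proof (rule semidec_cong)
      fix zs :: "nat list"
      assume "length zs = Suc n"
      then obtain y m xs where zs: "zs = y # m # xs" by (auto simp: Suc length_Suc_conv)
      have trace: "computes (Prec f g) (m # xs) y \<longleftrightarrow>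
        (\<exists>ys. length ys = Suc m \<and> y = ys ! m \<and> computes f xs (ys ! 0) \<and>
          (\<forall>j<m. computes g (j # ys ! j # xs) (ys ! Suc j)))" (is "_ \<longleftrightarrow> ?T m y") for m y
      proof (induction m arbitrary: y)
        case 0
        show ?case
        proof
          assume "computes (Prec f g) (0 # xs) y"
          then show "?T 0 y" by (intro exI[of _ "[y]"]) (auto elim: computesE)
        qed (auto intro: computes.intros)
      next
        case (Suc m)
        show ?case
        proof
          assume "computes (Prec f g) (Suc m # xs) y"
          then obtain u where u: "computes (Prec f g) (m # xs) u" "computes g (m # u # xs) y"
            by (rule computesE(6))
          then obtain ys where ys: "length ys = Suc m" "u = ys ! m" "computes f xs (ys ! 0)"
            "\<forall>j<m. computes g (j # ys ! j # xs) (ys ! Suc j)" using Suc.IH by blast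
          then show "?T (Suc m) y" using u(2)
            by (intro exI[of _ "ys @ [y]"]) (auto simp: nth_append less_Suc_eq)
        next
          assume "?T (Suc m) y"
          then obtain ys where ys: "length ys = Suc (Suc m)" "y = ys ! Suc m" "computes f xs (ys ! 0)"
            "\<forall>j<Suc m. computes g (j # ys ! j # xs) (ys ! Suc j)" by blast
          then have "?T m (ys ! m)"
            by (intro exI[of _ "take (Suc m) ys"]) auto
          then have "computes (Prec f g) (m # xs) (ys ! m)" using Suc.IH by blast
          then show "computes (Prec f g) (Suc m # xs) y" using ys by (auto intro: computes.intros)
        qed
      qed
      show "(\<exists>c. hd zs = cnth c (hd (tl zs)) \<and> computes f (tl (tl zs)) (cnth c 0) \<and>
        (\<forall>j<hd (tl zs). computes g (j # cnth c j # tl (tl zs)) (cnth c (Suc j)))) \<longleftrightarrow>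
        computes (Prec f g) (tl zs) (hd zs)" (is "?L \<longleftrightarrow> _")
      proof
        assume ?L
        then obtain c where "y = cnth c m" "computes f xs (cnth c 0)"
          "\<forall>j<m. computes g (j # cnth c j # xs) (cnth c (Suc j))" by (auto simp: zs)
        then show "computes (Prec f g) (tl zs) (hd zs)"
          unfolding zs list.sel trace
          by (intro exI[of _ "map (cnth c) [0..<Suc m]"]) (auto simp del: upt_Suc)
      next
        assume "computes (Prec f g) (tl zs) (hd zs)"
        then obtain ys where "length ys = Suc m" "y = ys ! m" "computes f xs (ys ! 0)"
          "\<forall>j<m. computes g (j # ys ! j # xs) (ys ! Suc j)" unfolding zs list.sel trace by blast
        then show ?L unfolding zs by (intro exI[of _ "list_encode ys"]) auto
      qed
    qed
  qed
next
  case (Mini f)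
  have 1: "semidec (Suc n) (\<lambda>zs. computes f (hd zs # tl zs) 0)"
  proof -
    have "vec_rec (Suc n) (Suc (Suc n)) (\<lambda>zs. 0 # hd zs # tl zs)" by (rule trec)+
    from semidec_comp[OF Mini.IH this] show ?thesis by simp
  qed
  have 2: "semidec (Suc (Suc (Suc n))) (\<lambda>zs. computes f (hd (tl zs) # tl (tl (tl zs))) (Suc (hd zs)))"
  proof -
    have "vec_rec (Suc (Suc (Suc n))) (Suc (Suc n)) (\<lambda>zs. Suc (hd zs) # hd (tl zs) # tl (tl (tl zs)))" by (rule trec)+
    from semidec_comp[OF Mini.IH this] show ?thesis by simp
  qed
  have "semidec (Suc n) (\<lambda>zs. computes f (hd zs # tl zs) 0 \<and>
     (\<forall>m<hd zs. \<exists>k. computes f (m # tl zs) (Suc k)))"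
    by (rule 1 2 trec)+
  then show ?case by (rule semidec_cong) (auto intro: computes.mini elim: computesE(7))
qed

lemma semidec_halts: "semidec n (halts f)"
  using semidec_ex[OF semidec_computes[of n f]] by (simp add: halts_def[abs_def])

text \<open>Post's theorem under a promise: on an input from \<open>A\<close> exactly one of the two
  searches succeeds, so minimising the product of their functions halts, and the value of
  \<open>G\<close> at the stage found tells which one it was.\<close>

lemma decidable_on_if_semidec:
  assumes "semidec n P" "semidec n P'"
    and enc: "\<And>x. x \<in> A \<Longrightarrow> length (enc x) = n" "\<And>x. x \<in> A \<Longrightarrow> P (enc x) \<longleftrightarrow> Q x"
      "\<And>x. x \<in> A \<Longrightarrow> P' (enc x) \<longleftrightarrow> \<not> Q x"
  shows "decidable_on A enc Q"
proof -
  obtain G G' where G: "total_rec (Suc n) G" "\<And>xs. length xs = n \<Longrightarrow> P xs = (\<exists>k. G (k # xs) = 0)"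
    and G': "total_rec (Suc n) G'" "\<And>xs. length xs = n \<Longrightarrow> P' xs = (\<exists>k. G' (k # xs) = 0)"
    using assms(1,2) unfolding semidec_def by blast
  have "total_rec (Suc n) (\<lambda>zs. G zs * G' zs)" by (rule trec G G')+
  then obtain f where f: "\<And>zs. length zs = Suc n \<Longrightarrow> computes f zs (G zs * G' zs)"
    by (auto simp: total_rec_def)
  have "total_rec (Suc n) (\<lambda>zs. 1 - G zs)" by (rule trec G)+
  then obtain h where h: "\<And>zs. length zs = Suc n \<Longrightarrow> computes h zs (1 - G zs)"
    by (auto simp: total_rec_def)
  \<comment> \<open>These programs return the single arguments, so that \<open>h\<close> receives
    the stage followed by the original input.\<close>
  obtain gs where gs: "\<And>xs. length xs = n \<Longrightarrow> list_all2 (\<lambda>g y. computes g xs y) gs xs"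
    using vec_rec_programs[OF vec_rec_id] by blast
  have "computes (Comp h (Mini f # gs)) (enc x) (if Q x then 1 else 0)" if x: "x \<in> A" for x
  proof -
    define xs where "xs = enc x"
    have xs: "length xs = n" "P xs \<longleftrightarrow> Q x" "P' xs \<longleftrightarrow> \<not> Q x"
      using enc x by (auto simp: xs_def)
    have ex: "\<exists>k. G (k # xs) * G' (k # xs) = 0"
      using G(2) G'(2) xs by (cases "Q x") auto
    define k where "k = (LEAST k. G (k # xs) * G' (k # xs) = 0)"
    have k: "G (k # xs) * G' (k # xs) = 0" unfolding k_def using ex by (rule LeastI_ex)
    have "computes (Mini f) xs k"
    proof (intro computes.mini allI impI)
      show "computes f (k # xs) 0" using f[of "k # xs"] k xs by simp
      fix m assume "m < k"
      then have "G (m # xs) * G' (m # xs) \<noteq> 0" unfolding k_def by (rule not_less_Least)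
      then show "\<exists>j. computes f (m # xs) (Suc j)"
        using f[of "m # xs"] xs(1) by (metis length_Cons not0_implies_Suc)
    qed
    then have "computes (Comp h (Mini f # gs)) xs (1 - G (k # xs))"
      using h[of "k # xs"] gs xs(1) by (auto intro!: computes.comp)
    moreover have "1 - G (k # xs) = (if Q x then 1 else 0)"
    proof (cases "G (k # xs) = 0")
      case True
      then have "P xs" using G(2) xs by blast
      then show ?thesis using True xs by simp
    next
      case False
      then have "P' xs" using G'(2) xs k by auto
      then show ?thesis using False xs by simp
    qed
    ultimately show ?thesis by (simp add: xs_def)
  qed
  then show ?thesis unfolding decidable_on_def by blast
qed

section \<open>The Skolem chase\<close>

lemma map_atom_tval_cong:
  "(\<And>x. x \<in> avars a \<Longrightarrow> v x = v' x) \<Longrightarrow> map_atom (tval v) a = map_atom (tval v') a"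
proof (rule atom.map_cong0)
  fix t assume *: "\<And>x. x \<in> avars a \<Longrightarrow> v x = v' x" "t \<in> set_atom a"
  then show "tval v t = tval v' t" by (cases t) (force simp: avars_def)+
qed

lemma map_atom_tval_comp:
  assumes "\<And>c. h (Const c) = Const c"
  shows "map_atom h (map_atom (tval v) a) = map_atom (tval (\<lambda>x. h (v x))) a"
proof -
  have "h (tval v t) = tval (\<lambda>x. h (v x)) t" for t by (cases t) (simp_all add: assms)
  then show ?thesis by (simp add: atom.map_comp o_def)
qed

lemma atom_over_map_atom [simp]: "atom_over S (map_atom f a) = atom_over S a"
  by (cases a) (simp add: atom_over_def)

lemma avars_subset:
  "a \<in> set (body r) \<Longrightarrow> avars a \<subseteq> body_vars r" "a \<in> set (head r) \<Longrightarrow> avars a \<subseteq> head_vars r"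
  by (auto simp: body_vars_def head_vars_def)

lemma finite_avars: "finite (avars a)"
proof -
  have "finite (tvars t)" for t by (cases t) auto
  moreover have "finite (set_atom a)" by (cases a) simp
  ultimately show ?thesis unfolding avars_def by blast
qed

lemma finite_body_vars: "finite (body_vars r)" and finite_head_vars: "finite (head_vars r)"
  by (auto simp: body_vars_def head_vars_def finite_avars)

text \<open>A match of a body only matters on finitely many variables, and a list, unlike a
  valuation, has a code. The default \<open>Const 0\<close> has code 0, which is also what
  \<open>cnth\<close> returns out of range.\<close>

definition lval :: "gterm list \<Rightarrow> nat \<Rightarrow> gterm" where
  "lval vs x = (if x < length vs then vs ! x else Const 0)"

text \<open>The name of a null is the code of its Skolem term. It records all of \<open>vs\<close>,
  so matches that agree on the body may create different nulls; this is harmless, as the chase only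
  has to satisfy the rules and map into other models.\<close>

definition skolem :: "rule \<Rightarrow> gterm list \<Rightarrow> nat \<Rightarrow> gterm" where
  "skolem r vs x = (if x \<in> body_vars r then lval vs x
     else Null (pair (enc_rule r) (pair x (list_encode (map enc_gterm vs)))))"

inductive_set chase :: "inst \<Rightarrow> rule set \<Rightarrow> inst" for D R where
  base: "a \<in> D \<Longrightarrow> a \<in> chase D R"
| step: "r \<in> R \<Longrightarrow> \<forall>b\<in>set (body r). map_atom (tval (lval vs)) b \<in> chase D R \<Longrightarrow>
    a \<in> set (head r) \<Longrightarrow> map_atom (tval (skolem r vs)) a \<in> chase D R"

lemma sat_rule_chase:
  assumes "r \<in> R"
  shows "sat_rule (chase D R) r"
  unfolding sat_rule_def
proof (intro allI impI)
  fix v assume v: "\<forall>a\<in>set (body r). map_atom (tval v) a \<in> chase D R"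
  obtain m where m: "\<And>x. x \<in> body_vars r \<Longrightarrow> x < m"
    using finite_body_vars[of r] by (meson finite_nat_set_iff_bounded)
  \<comment> \<open>The valuation is cut off at a bound for the body variables.\<close>
  define vs where "vs = map v [0..<m]"
  have vs: "lval vs x = v x" if "x \<in> body_vars r" for x
    using m[OF that] by (simp add: lval_def vs_def)
  have "map_atom (tval (lval vs)) a = map_atom (tval v) a" if "a \<in> set (body r)" for a
    using avars_subset(1)[OF that] vs by (intro map_atom_tval_cong) auto
  then have "\<forall>a\<in>set (head r). map_atom (tval (skolem r vs)) a \<in> chase D R"
    using v assms by (auto intro: chase.step)
  moreover have "\<forall>x\<in>body_vars r. skolem r vs x = v x" by (simp add: skolem_def vs)
  ultimately show "\<exists>v'. (\<forall>x\<in>body_vars r. v' x = v x) \<and> (\<forall>a\<in>set (head r). map_atom (tval v') a \<in> chase D R)"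
    by blast
qed

text \<open>Surjectivity makes \<open>inv enc_gterm\<close> preserve codes, which bounds the
  recursion below, and later lets number quantifiers stand for quantifiers over valuations.\<close>

lemma surj_enc_gterm: "surj enc_gterm"
proof (rule surjI)
  fix n
  show "enc_gterm (case sum_decode n of Inl c \<Rightarrow> Const c | Inr m \<Rightarrow> Null m) = n"
  proof (cases "sum_decode n")
    case (Inl c)
    then have "sum_encode (Inl c) = n" by (metis sum_decode_inverse)
    with Inl show ?thesis by simp
  next
    case (Inr c)
    then have "sum_encode (Inr c) = n" by (metis sum_decode_inverse)
    with Inr show ?thesis by simp
  qed
qed

lemma list_decode_nth_le: "i < length (list_decode l) \<Longrightarrow> list_decode l ! i \<le> l"
proof -
  have "i < length xs \<Longrightarrow> xs ! i \<le> list_encode xs" for xs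
  proof (induction xs arbitrary: i)
    case (Cons x xs)
    have "x \<le> prod_encode (x, list_encode xs)" "list_encode xs \<le> prod_encode (x, list_encode xs)"
      by (rule le_prod_encode_1 le_prod_encode_2)+
    with Cons show ?case by (cases i) force+
  qed simp
  then show "i < length (list_decode l) \<Longrightarrow> list_decode l ! i \<le> l"
    by (metis list_decode_inverse)
qed

text \<open>A Skolem null contains the codes of its rule, its variable and its valuation, so a homomorphism
  from the chase is defined by recursion on codes; \<open>W r u\<close> extends the match \<open>u\<close> of the body of \<open>r\<close>
  in the target to a match of its head.\<close>

function skolem_hom :: "(rule \<Rightarrow> (nat \<Rightarrow> gterm) \<Rightarrow> nat \<Rightarrow> gterm) \<Rightarrow> gterm \<Rightarrow> gterm" where
  "skolem_hom W (Const c) = Const c"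
| "skolem_hom W (Null n) = W (inv enc_rule (pfst n))
     (\<lambda>y. skolem_hom W (lval (map (inv enc_gterm) (list_decode (psnd (psnd n)))) y)) (pfst (psnd n))"
  by pat_completeness auto
termination
proof (relation "measure (\<lambda>(W, t). enc_gterm t)")
  fix W :: "rule \<Rightarrow> (nat \<Rightarrow> gterm) \<Rightarrow> nat \<Rightarrow> gterm" and n y
  \<comment> \<open>The code of a list entry is at most the code of the list, hence at most
    \<open>n\<close>, while \<open>Null n\<close> has code \<open>2 * n + 1\<close>; the default of
    \<open>lval\<close> has code 0.\<close>
  let ?l = "psnd (psnd n)"
  have "?l \<le> n" using pair_ge(2)[of "psnd n" "pfst n"] pair_ge(2)[of ?l "pfst (psnd n)"] by simp
  moreover have "enc_gterm (lval (map (inv enc_gterm) (list_decode ?l)) y) \<le> ?l"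
    using list_decode_nth_le[of y ?l]
    by (auto simp: lval_def f_inv_into_f surj_enc_gterm sum_encode_def)
  ultimately show "((W, lval (map (inv enc_gterm) (list_decode ?l)) y), W, Null n) \<in> measure (\<lambda>(W, t). enc_gterm t)"
    by (simp add: sum_encode_def)
qed simp

lemma skolem_hom_null:
  "skolem_hom W (Null (pair (enc_rule r) (pair x (list_encode (map enc_gterm vs))))) =
     W r (\<lambda>y. skolem_hom W (lval vs y)) x"
proof -
  have "inv enc_gterm \<circ> enc_gterm = id" using inj_enc_gterm by (rule inv_o_cancel)
  then show ?thesis by (simp add: inv_f_f[OF inj_enc_rule])
qed

lemma chase_hom:
  assumes D: "adom D \<subseteq> range Const" "D \<subseteq> J" and J: "\<forall>r\<in>R. sat_rule J r"
  obtains h where "\<And>c. h (Const c) = Const c" "\<And>a. a \<in> chase D R \<Longrightarrow> map_atom h a \<in> J"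
proof -
  define W where "W r u = (SOME v'. (\<forall>x\<in>body_vars r. v' x = u x) \<and>
    (\<forall>a\<in>set (head r). map_atom (tval v') a \<in> J))" for r and u :: "nat \<Rightarrow> gterm"
  define h where "h = skolem_hom W"
  have h: "h (Const c) = Const c" for c by (simp add: h_def)
  have "map_atom h a \<in> J" if "a \<in> chase D R" for a
    using that
  proof induction
    case (base a)
    then have "h t = t" if "t \<in> set_atom a" for t
      using that D(1) h unfolding adom_def by blast
    then have "map_atom h a = a" by (metis atom.map_cong0 atom.map_id0 id_apply)
    then show ?case using base D(2) by auto
  next
    case (step r vs a)
    define u where "u = (\<lambda>x. h (lval vs x))"
    have "\<forall>b\<in>set (body r). map_atom (tval u) b \<in> J"
      using step.IH by (simp add: map_atom_tval_comp[OF h] u_def)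
    then have "\<exists>v'. (\<forall>x\<in>body_vars r. v' x = u x) \<and> (\<forall>a\<in>set (head r). map_atom (tval v') a \<in> J)"
      using J step.hyps unfolding sat_rule_def by blast
    then have W: "\<forall>x\<in>body_vars r. W r u x = u x" "map_atom (tval (W r u)) a \<in> J"
      using someI_ex[of "\<lambda>v'. (\<forall>x\<in>body_vars r. v' x = u x) \<and> (\<forall>a\<in>set (head r). map_atom (tval v') a \<in> J)"]
        step.hyps unfolding W_def by blast+
    \<comment> \<open>On body variables the chosen extension agrees with \<open>u\<close>; on the
      others this is the recursion equation of \<open>skolem_hom\<close>.\<close>
    have "h (skolem r vs x) = W r u x" for x
      using W(1) by (simp add: skolem_def u_def h_def skolem_hom_null del: skolem_hom.simps)
    then show ?case using W(2) by (simp add: map_atom_tval_comp[OF h])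
  qed
  then show thesis using h that by blast
qed

text \<open>Heads of query rules carry IDB predicates, so \<open>I\<close> together with all atoms
  outside \<open>S\<close> is closed under the query rules and bounds the closure. Query rules thus
  feed nothing back to rules over \<open>S\<close>.\<close>

lemma atom_in_datalog_closure:
  assumes "datalog_query S q" "instance_over S I" "a \<in> datalog_closure (set (rules q)) I" "a \<notin> I"
  shows "pred_of a \<notin> S"
proof -
  let ?J = "I \<union> {a. pred_of a \<notin> S}"
  have "sat_rule ?J r" if r: "r \<in> set (rules q)" for r
  proof -
    have "pred_of a \<notin> S" if "a \<in> set (head r)" for a
      using assms(1) r that unfolding datalog_query_def rule_over_def atom_over_def by blast
    then have "\<forall>a\<in>set (head r). map_atom (tval v) a \<in> ?J" for v
      by (auto simp: atom.map_sel)
    then show ?thesis unfolding sat_rule_def by blast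
  qed
  then have "datalog_closure (set (rules q)) I \<subseteq> ?J"
    using assms(1) by (intro datalog_closure_least(3)) (auto simp: datalog_query_def)
  then show ?thesis using assms(3,4) by blast
qed

text \<open>Chasing both kinds of rules together is sound because they do not interact backwards.
  The part of the joint chase over \<open>S\<close> is a model, whose query closure stays inside the
  chase. Conversely, the query closure of any model satisfies all rules, so the chase maps into
  it.\<close>

lemma entails_iff_chase:
  assumes D: "database S D" and R: "\<forall>r\<in>R. rule_over S r" and q: "datalog_query S q"
  shows "entails S D R (q, p) \<longleftrightarrow> Atom (goal q) [] \<in> chase D (R \<union> set (rules q))"
proof
  assume entails: "entails S D R (q, p)"
  define C where "C = chase D (R \<union> set (rules q))"
  define I where "I = {a\<in>C. atom_over S a}"
  have sat: "\<forall>r\<in>R \<union> set (rules q). sat_rule C r" unfolding C_def by (blast intro: sat_rule_chase)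
  have "sat_rule I r" if r: "r \<in> R" for r
    unfolding sat_rule_def
  proof (intro allI impI)
    fix v assume "\<forall>a\<in>set (body r). map_atom (tval v) a \<in> I"
    then have "\<forall>a\<in>set (body r). map_atom (tval v) a \<in> C" by (simp add: I_def)
    then obtain v' where v': "\<forall>x\<in>body_vars r. v' x = v x" "\<forall>a\<in>set (head r). map_atom (tval v') a \<in> C"
      using sat r unfolding sat_rule_def by blast
    have "\<forall>a\<in>set (head r). map_atom (tval v') a \<in> I"
      using v'(2) R r by (auto simp: I_def rule_over_def)
    with v'(1) show "\<exists>v'. (\<forall>x\<in>body_vars r. v' x = v x) \<and> (\<forall>a\<in>set (head r). map_atom (tval v') a \<in> I)"
      by blast
  qed
  moreover have "D \<subseteq> I"
    using D by (auto simp: I_def C_def database_def instance_over_def intro: chase.base)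
  ultimately have "is_model S D R I" by (simp add: is_model_def instance_over_def I_def)
  then have "Atom (goal q) [] \<in> datalog_closure (set (rules q)) I"
    using entails by (simp add: entails_def sat_query_def)
  also have "\<dots> \<subseteq> C"
    using q sat by (intro datalog_closure_least(3)) (auto simp: datalog_query_def I_def)
  finally show "Atom (goal q) [] \<in> chase D (R \<union> set (rules q))" by (simp add: C_def)
next
  assume goal: "Atom (goal q) [] \<in> chase D (R \<union> set (rules q))"
  show "entails S D R (q, p)"
    unfolding entails_def
  proof (intro allI impI)
    fix I assume I: "is_model S D R I"
    define J where "J = datalog_closure (set (rules q)) I"
    have dl: "\<forall>r\<in>set (rules q). datalog_rule r" using q by (simp add: datalog_query_def)
    have IJ: "I \<subseteq> J" unfolding J_def by (rule datalog_closure_least(1)[OF dl])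
    have "sat_rule J r" if r: "r \<in> R" for r
      unfolding sat_rule_def
    proof (intro allI impI)
      fix v assume v: "\<forall>a\<in>set (body r). map_atom (tval v) a \<in> J"
      \<comment> \<open>The body of \<open>r\<close> is over \<open>S\<close>, and the closure adds
        no atoms over \<open>S\<close>, so the match already lies in \<open>I\<close>.\<close>
      have "map_atom (tval v) a \<in> I" if "a \<in> set (body r)" for a
      proof (rule ccontr)
        assume "map_atom (tval v) a \<notin> I"
        then have "pred_of (map_atom (tval v) a) \<notin> S"
          using atom_in_datalog_closure[OF q] v that I by (auto simp: is_model_def J_def)
        then show False using R r that by (auto simp: rule_over_def atom_over_def atom.map_sel)
      qed
      then obtain v' where "\<forall>x\<in>body_vars r. v' x = v x" "\<forall>a\<in>set (head r). map_atom (tval v') a \<in> I"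
        using I r unfolding is_model_def sat_rule_def by blast
      then show "\<exists>v'. (\<forall>x\<in>body_vars r. v' x = v x) \<and> (\<forall>a\<in>set (head r). map_atom (tval v') a \<in> J)"
        using IJ by blast
    qed
    moreover have "\<forall>r\<in>set (rules q). sat_rule J r"
      unfolding J_def by (rule datalog_closure_least(2)[OF dl])
    ultimately have "\<forall>r\<in>R \<union> set (rules q). sat_rule J r" by blast
    moreover have "adom D \<subseteq> range Const" "D \<subseteq> J" using D I IJ by (auto simp: database_def is_model_def)
    ultimately obtain h where "\<And>a. a \<in> chase D (R \<union> set (rules q)) \<Longrightarrow> map_atom h a \<in> J"
      using chase_hom by metis
    \<comment> \<open>The goal atom has no arguments and is fixed by \<open>h\<close>.\<close>
    from this[OF goal] show "sat_query I (fst (q, p))" by (simp add: sat_query_def J_def)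
  qed
qed

section \<open>Finite derivations in the chase\<close>

definition chase_step :: "inst \<Rightarrow> rule set \<Rightarrow> inst \<Rightarrow> gterm atom \<Rightarrow> bool" where
  "chase_step D R X a \<longleftrightarrow> a \<in> D \<or>
     (\<exists>r\<in>R. \<exists>vs. (\<forall>b\<in>set (body r). map_atom (tval (lval vs)) b \<in> X) \<and>
       (\<exists>h\<in>set (head r). a = map_atom (tval (skolem r vs)) h))"

text \<open>A linear derivation can be coded by one number, which makes membership in the chase an
  existential statement over numbers.\<close>

definition chase_sequence :: "inst \<Rightarrow> rule set \<Rightarrow> gterm atom list \<Rightarrow> bool" where
  "chase_sequence D R s \<longleftrightarrow> (\<forall>i<length s. chase_step D R (set (take i s)) (s ! i))"

lemma chase_step_mono: "chase_step D R X a \<Longrightarrow> X \<subseteq> Y \<Longrightarrow> chase_step D R Y a"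
  unfolding chase_step_def by blast

lemma chase_step_chase: "chase_step D R X a \<Longrightarrow> X \<subseteq> chase D R \<Longrightarrow> a \<in> chase D R"
  unfolding chase_step_def by (elim disjE bexE exE conjE) (auto intro: chase.base, blast intro: chase.step)

lemma chase_sequence_append:
  assumes "chase_sequence D R s" "chase_sequence D R t"
  shows "chase_sequence D R (s @ t)"
  unfolding chase_sequence_def
proof (intro allI impI)
  fix i assume i: "i < length (s @ t)"
  show "chase_step D R (set (take i (s @ t))) ((s @ t) ! i)"
  proof (cases "i < length s")
    case True
    then show ?thesis using assms(1) by (simp add: chase_sequence_def nth_append)
  next
    case False
    then have "chase_step D R (set (take (i - length s) t)) (t ! (i - length s))"
      using assms(2) i by (simp add: chase_sequence_def)
    then show ?thesis using False by (auto simp: nth_append intro: chase_step_mono)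
  qed
qed

lemma chase_sequence_snoc:
  assumes "chase_sequence D R s" "chase_step D R (set s) a"
  shows "chase_sequence D R (s @ [a])"
  using assms by (auto simp: chase_sequence_def nth_append less_Suc_eq)

lemma chase_iff_sequence: "a \<in> chase D R \<longleftrightarrow> (\<exists>s. chase_sequence D R s \<and> a \<in> set s)"
proof
  assume "a \<in> chase D R"
  then show "\<exists>s. chase_sequence D R s \<and> a \<in> set s"
  proof induction
    case (base a)
    then have "chase_sequence D R [a]" by (simp add: chase_sequence_def chase_step_def)
    then show ?case by (intro exI[of _ "[a]"]) simp
  next
    case (step r vs a)
    \<comment> \<open>Derivations of the finitely many body atoms are concatenated one after the
      other.\<close>
    have "\<exists>s. chase_sequence D R s \<and> (\<forall>b\<in>set bs. map_atom (tval (lval vs)) b \<in> set s)"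
      if "set bs \<subseteq> set (body r)" for bs
      using that
    proof (induction bs)
      case Nil
      then show ?case by (intro exI[of _ "[]"]) (simp add: chase_sequence_def)
    next
      case (Cons b bs)
      then obtain s where s: "chase_sequence D R s" "\<forall>b\<in>set bs. map_atom (tval (lval vs)) b \<in> set s" by auto
      from Cons.prems step.IH obtain t where "chase_sequence D R t" "map_atom (tval (lval vs)) b \<in> set t"
        by auto
      with s show ?case by (intro exI[of _ "s @ t"]) (auto intro: chase_sequence_append)
    qed
    from this[of "body r"] obtain s where s: "chase_sequence D R s"
      "\<forall>b\<in>set (body r). map_atom (tval (lval vs)) b \<in> set s" by blast
    have "chase_step D R (set s) (map_atom (tval (skolem r vs)) a)"
      unfolding chase_step_def using s(2) step.hyps by blast
    then have "chase_sequence D R (s @ [map_atom (tval (skolem r vs)) a])"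
      using s(1) by (rule chase_sequence_snoc[rotated])
    then show ?case by (intro exI[of _ "s @ [map_atom (tval (skolem r vs)) a]"]) simp
  qed
next
  assume "\<exists>s. chase_sequence D R s \<and> a \<in> set s"
  then obtain s where s: "chase_sequence D R s" "a \<in> set s" by blast
  have "s ! i \<in> chase D R" if "i < length s" for i
    using that
  proof (induction i rule: less_induct)
    case (less i)
    have "chase_step D R (set (take i s)) (s ! i)" using s(1) less.prems by (simp add: chase_sequence_def)
    moreover have "set (take i s) \<subseteq> chase D R" using less by (auto simp: in_set_conv_nth)
    ultimately show ?case by (rule chase_step_chase)
  qed
  then show "a \<in> chase D R" using s(2) by (auto simp: in_set_conv_nth)
qed

section \<open>Models without the query as models of a sentence\<close>

text \<open>The final equation stands for truth; constants denote themselves even outside the active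
  domain.\<close>

definition mso_conj :: "mso list \<Rightarrow> mso" where
  "mso_conj ps = foldr MAnd ps (MEq (Cst 0) (Cst 0))"

definition mso_exs :: "nat list \<Rightarrow> mso \<Rightarrow> mso" where
  "mso_exs xs p = foldr MEx xs p"

lemma mso_sat_conj: "mso_sat I v V (mso_conj ps) \<longleftrightarrow> (\<forall>p\<in>set ps. mso_sat I v V p)"
  by (induction ps) (auto simp: mso_conj_def)

lemma mso_sat_exs:
  "mso_sat I v V (mso_exs xs p) \<longleftrightarrow>
     (\<exists>v'. (\<forall>x\<in>set xs. v' x \<in> adom I) \<and> (\<forall>x. x \<notin> set xs \<longrightarrow> v' x = v x) \<and> mso_sat I v' V p)"
proof (induction xs arbitrary: v)
  case Nil
  have "v' = v" if "\<forall>x. v' x = v x" for v' using that by auto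
  then show ?case by (auto simp: mso_exs_def)
next
  case (Cons x xs)
  have "mso_sat I v V (mso_exs (x # xs) p) \<longleftrightarrow>
    (\<exists>d\<in>adom I. \<exists>v'. (\<forall>y\<in>set xs. v' y \<in> adom I) \<and> (\<forall>y. y \<notin> set xs \<longrightarrow> v' y = (v(x := d)) y) \<and> mso_sat I v' V p)"
    unfolding Cons.IH[symmetric] by (simp add: mso_exs_def del: fun_upd_apply)
  also have "\<dots> \<longleftrightarrow> (\<exists>v'. (\<forall>y\<in>set (x # xs). v' y \<in> adom I) \<and>
    (\<forall>y. y \<notin> set (x # xs) \<longrightarrow> v' y = v y) \<and> mso_sat I v' V p)" (is "?L \<longleftrightarrow> ?R")
  proof
    assume ?L
    then obtain d v' where v': "d \<in> adom I" "\<forall>y\<in>set xs. v' y \<in> adom I"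
      "\<forall>y. y \<notin> set xs \<longrightarrow> v' y = (v(x := d)) y" "mso_sat I v' V p" by blast
    then have "v' x \<in> adom I" by (cases "x \<in> set xs") auto
    with v' show ?R by (intro exI[of _ v']) auto
  next
    assume ?R
    then obtain v' where "\<forall>y\<in>set (x # xs). v' y \<in> adom I"
      "\<forall>y. y \<notin> set (x # xs) \<longrightarrow> v' y = v y" "mso_sat I v' V p" by blast
    then show ?L by (intro bexI[of _ "v' x"] exI[of _ v']) auto
  qed
  finally show ?case .
qed

lemma mso_conj_simps [simp]:
  "fo_free (mso_conj ps) = (\<Union>p\<in>set ps. fo_free p)"
  "so_free (mso_conj ps) = (\<Union>p\<in>set ps. so_free p)"
  "mso_over S (mso_conj ps) \<longleftrightarrow> (\<forall>p\<in>set ps. mso_over S p)"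
  by (induction ps) (auto simp: mso_conj_def)

lemma mso_exs_simps [simp]:
  "fo_free (mso_exs xs p) = fo_free p - set xs"
  "so_free (mso_exs xs p) = so_free p"
  "mso_over S (mso_exs xs p) \<longleftrightarrow> mso_over S p"
  by (induction xs) (auto simp: mso_exs_def)

definition mso_rule :: "rule \<Rightarrow> mso" where
  "mso_rule r = MNot (mso_exs (sorted_list_of_set (body_vars r))
     (MAnd (mso_conj (map MAtom (body r)))
        (MNot (mso_exs (sorted_list_of_set (head_vars r - body_vars r)) (mso_conj (map MAtom (head r)))))))"

lemma mso_rule_simps [simp]:
  "fo_free (mso_rule r) = {}" "so_free (mso_rule r) = {}"
  "mso_over S (mso_rule r) \<longleftrightarrow> rule_over S r"
  using avars_subset[of _ r]
  by (auto simp: mso_rule_def rule_over_def finite_body_vars finite_head_vars)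

lemma tval_in_adom:
  assumes "map_atom (tval v) a \<in> I" "x \<in> avars a"
  shows "v x \<in> adom I"
proof -
  obtain t where "t \<in> set_atom a" "x \<in> tvars t" using assms(2) by (auto simp: avars_def)
  then have "Var x \<in> set_atom a" by (cases t rule: trm.exhaust) auto
  then have "tval v (Var x) \<in> set_atom (map_atom (tval v) a)"
    unfolding atom.set_map by (rule imageI)
  then show ?thesis using assms(1) by (auto simp: adom_def)
qed

text \<open>MSO quantifiers range over \<open>adom I\<close>, the valuations in
  \<open>sat_rule\<close> over all terms. The two agree because a variable occurring in a matched
  atom takes a value in \<open>adom I\<close>, and the values of all other variables can be
  reset.\<close>

lemma mso_sat_rule: "mso_sat I v V (mso_rule r) \<longleftrightarrow> sat_rule I r"
proof -
  let ?ex = "\<lambda>u. \<exists>v'. (\<forall>x\<in>body_vars r. v' x = u x) \<and> (\<forall>a\<in>set (head r). map_atom (tval v') a \<in> I)"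
  have head: "mso_sat I u V (mso_exs (sorted_list_of_set (head_vars r - body_vars r)) (mso_conj (map MAtom (head r))))
    \<longleftrightarrow> ?ex u" for u
  proof
    assume "?ex u"
    then obtain v' where v': "\<forall>x\<in>body_vars r. v' x = u x" "\<forall>a\<in>set (head r). map_atom (tval v') a \<in> I" by blast
    \<comment> \<open>\<open>mso_sat_exs\<close> demands agreement with \<open>u\<close> off the
      quantified variables, so values at variables foreign to the rule are taken from
      \<open>u\<close>.\<close>
    define v'' where "v'' x = (if x \<in> head_vars r \<union> body_vars r then v' x else u x)" for x
    have "map_atom (tval v'') a = map_atom (tval v') a" if "a \<in> set (head r)" for a
      using avars_subset(2)[OF that] by (intro map_atom_tval_cong) (auto simp: v''_def)
    moreover have "v'' x \<in> adom I" if "x \<in> head_vars r" for x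
      using that v'(2) by (auto simp: v''_def head_vars_def intro: tval_in_adom)
    ultimately show "mso_sat I u V (mso_exs (sorted_list_of_set (head_vars r - body_vars r)) (mso_conj (map MAtom (head r))))"
      unfolding mso_sat_exs using v'
      by (intro exI[of _ v'']) (auto simp: mso_sat_conj finite_head_vars v''_def)
  qed (auto simp: mso_sat_exs mso_sat_conj finite_head_vars)
  have "mso_sat I v V (mso_rule r) \<longleftrightarrow>
    \<not> (\<exists>u. (\<forall>x\<in>body_vars r. u x \<in> adom I) \<and> (\<forall>x. x \<notin> body_vars r \<longrightarrow> u x = v x) \<and>
      (\<forall>a\<in>set (body r). map_atom (tval u) a \<in> I) \<and> \<not> ?ex u)"
    by (simp add: mso_rule_def mso_sat_exs[of _ _ _ "sorted_list_of_set (body_vars r)"] head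
        mso_sat_conj finite_body_vars)
  also have "\<dots> \<longleftrightarrow> \<not> (\<exists>u. (\<forall>a\<in>set (body r). map_atom (tval u) a \<in> I) \<and> \<not> ?ex u)"
  proof -
    have "\<exists>w. (\<forall>x\<in>body_vars r. w x \<in> adom I) \<and> (\<forall>x. x \<notin> body_vars r \<longrightarrow> w x = v x) \<and>
      (\<forall>a\<in>set (body r). map_atom (tval w) a \<in> I) \<and> \<not> ?ex w"
      if u: "\<forall>a\<in>set (body r). map_atom (tval u) a \<in> I" "\<not> ?ex u" for u
    proof -
      define w where "w x = (if x \<in> body_vars r then u x else v x)" for x
      have "map_atom (tval w) a = map_atom (tval u) a" if "a \<in> set (body r)" for a
        using avars_subset(1)[OF that] by (intro map_atom_tval_cong) (auto simp: w_def)
      moreover have "w x \<in> adom I" if "x \<in> body_vars r" for x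
        using that u(1) by (auto simp: w_def body_vars_def intro: tval_in_adom)
      ultimately show ?thesis using u by (intro exI[of _ w]) (simp add: w_def)
    qed
    then show ?thesis by blast
  qed
  finally show ?thesis unfolding sat_rule_def by blast
qed

text \<open>Databases contain no nulls, so the second equation is irrelevant.\<close>

fun trm_of :: "gterm \<Rightarrow> trm" where
  "trm_of (Const c) = Cst c"
| "trm_of (Null n) = Cst n"

definition mso_db :: "gterm atom list \<Rightarrow> mso" where
  "mso_db D = mso_conj (map (\<lambda>a. MAtom (map_atom trm_of a)) D)"

lemma mso_sat_db:
  assumes "adom (set D) \<subseteq> range Const"
  shows "mso_sat I v V (mso_db D) \<longleftrightarrow> set D \<subseteq> I"
proof -
  have "map_atom (tval v) (map_atom trm_of a) = a" if "a \<in> set D" for a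
  proof -
    have "tval v (trm_of t) = t" if "t \<in> set_atom a" for t
      using assms \<open>a \<in> set D\<close> that unfolding adom_def by fastforce
    then show ?thesis by (simp add: atom.map_comp o_def atom.map_ident_strong)
  qed
  then show ?thesis by (auto simp: mso_db_def mso_sat_conj)
qed

lemma avars_trm_of: "avars (map_atom trm_of a) = {}"
proof -
  have "tvars (trm_of t) = {}" for t by (cases t) auto
  then show ?thesis by (auto simp: avars_def atom.set_map)
qed

definition refutation :: "gterm atom list \<Rightarrow> rule list \<Rightarrow> mso \<Rightarrow> mso" where
  "refutation D rs p = MAnd (mso_db D) (MAnd (mso_conj (map mso_rule rs)) (MNot p))"

lemma mso_sentence_refutation:
  assumes "instance_over S (set D)" "\<forall>r\<in>set rs. rule_over S r" "mso_sentence S p"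
  shows "mso_sentence S (refutation D rs p)"
  using assms
  by (auto simp: mso_sentence_def refutation_def mso_db_def instance_over_def avars_trm_of)

lemma sat_refutation:
  assumes "database S (set D)" "\<forall>r\<in>set rs. rule_over S r" "mso_sentence S p" "instance_over S I"
  shows "sat_mso I (refutation D rs p) \<longleftrightarrow> is_model S (set D) (set rs) I \<and> \<not> sat_mso I p"
proof -
  have "mso_sentence S (refutation D rs p)"
    using assms mso_sentence_refutation by (simp add: database_def)
  from sat_mso_sentence[OF this] sat_mso_sentence[OF assms(3)] show ?thesis
    using assms(1,4)
    by (simp add: refutation_def mso_sat_db mso_sat_conj mso_sat_rule is_model_def database_def)
qed

text \<open>The atoms that are mapped into the closure of \<open>J\<close> contain \<open>I\<close>
  and are closed under the query rules, hence include the closure of \<open>I\<close>; the nullary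
  goal is its own image.\<close>

lemma sat_query_hom:
  assumes h: "homomorphism I J h" and dl: "\<forall>r\<in>set (rules q). datalog_rule r" and "sat_query I q"
  shows "sat_query J q"
proof -
  let ?C = "datalog_closure (set (rules q))"
  \<comment> \<open>A homomorphism is only controlled on \<open>adom I\<close>, but query rules may
    mention other constants; \<open>g\<close> fixes every constant and agrees with \<open>h\<close>
    on the atoms of \<open>I\<close>.\<close>
  define g where "g t = (case t of Const c \<Rightarrow> Const c | Null n \<Rightarrow> h t)" for t
  have g: "g (Const c) = Const c" for c by (simp add: g_def)
  let ?K = "{a. map_atom g a \<in> ?C J}"
  have "I \<subseteq> ?K"
  proof
    fix a assume a: "a \<in> I"
    have "g t = h t" if "t \<in> set_atom a" for t
      using h that a by (cases t) (auto simp: g_def homomorphism_def adom_def)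
    then have "map_atom g a = map_atom h a" by (rule atom.map_cong0)
    moreover have "map_atom h a \<in> J" using h a by (simp add: homomorphism_def)
    ultimately show "a \<in> ?K" using datalog_closure_least(1)[OF dl, of J] by auto
  qed
  moreover have "sat_rule ?K r" if r: "r \<in> set (rules q)" for r
    unfolding sat_rule_def
  proof (intro allI impI)
    fix v assume "\<forall>a\<in>set (body r). map_atom (tval v) a \<in> ?K"
    then have "\<forall>a\<in>set (body r). map_atom (tval (\<lambda>x. g (v x))) a \<in> ?C J"
      by (simp add: map_atom_tval_comp[OF g])
    then obtain v' where v': "\<forall>x\<in>body_vars r. v' x = g (v x)" "\<forall>a\<in>set (head r). map_atom (tval v') a \<in> ?C J"
      using datalog_closure_least(2)[OF dl] r unfolding sat_rule_def by blast
    have "map_atom (tval v') a = map_atom (tval (\<lambda>x. g (v x))) a" if "a \<in> set (head r)" for a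
      using avars_subset(2)[OF that] dl r v'(1)
      by (intro map_atom_tval_cong) (auto simp: datalog_rule_def)
    then have "\<forall>a\<in>set (head r). map_atom (tval v) a \<in> ?K"
      using v'(2) by (simp add: map_atom_tval_comp[OF g])
    then show "\<exists>v'. (\<forall>x\<in>body_vars r. v' x = v x) \<and> (\<forall>a\<in>set (head r). map_atom (tval v') a \<in> ?K)"
      by blast
  qed
  ultimately have "?C I \<subseteq> ?K" using datalog_closure_least(3)[OF dl] by blast
  then show ?thesis using assms(3) by (auto simp: sat_query_def)
qed

lemma not_entails_iff_halts:
  assumes fr: "\<forall>n p. mso_sentence S p \<longrightarrow>
        ((\<nexists>I. instance_over S I \<and> sat_mso I p) \<longrightarrow> \<not> halts f [n, enc_mso p]) \<and>
        ((\<exists>I. instance_over S I \<and> sat_mso I p \<and> w I \<le> enat n) \<longrightarrow> halts f [n, enc_mso p])"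
    and rs: "\<forall>r\<in>set rs. rule_over S r" and fin: "finite_width_set S w (set rs)"
    and D: "database S (set D)" and q: "damsoq S q p"
  shows "\<not> entails S (set D) (set rs) (q, p) \<longleftrightarrow> (\<exists>n. halts f [n, enc_mso (refutation D rs p)])"
proof
  let ?p = "refutation D rs p"
  have p: "mso_sentence S p" using q by (simp add: damsoq_def)
  have sent: "mso_sentence S ?p"
    using mso_sentence_refutation[OF _ rs p] D by (simp add: database_def)
  {
    assume "\<not> entails S (set D) (set rs) (q, p)"
    then obtain J where J: "is_model S (set D) (set rs) J" "\<not> sat_query J q"
      by (auto simp: entails_def)
    obtain I n where I: "universal_model S (set D) (set rs) I" "w I = enat n"
      using fin D unfolding finite_width_set_def by blast
    then obtain h where "homomorphism I J h" using J(1) by (auto simp: universal_model_def)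
    then have "\<not> sat_query I q"
      using sat_query_hom J(2) q by (auto simp: damsoq_def datalog_query_def)
    moreover have model: "is_model S (set D) (set rs) I" using I(1) by (simp add: universal_model_def)
    ultimately have "sat_mso I ?p"
      using sat_refutation[OF D rs p] q by (simp add: damsoq_def is_model_def)
    then show "\<exists>n. halts f [n, enc_mso ?p]"
      using fr sent I(2) model unfolding is_model_def by (metis order_refl)
  }
  {
    assume "\<exists>n. halts f [n, enc_mso ?p]"
    \<comment> \<open>Halting excludes unsatisfiability, by contraposition of the first clause of
      \<open>fr\<close>; this \<open>I\<close> may have any width.\<close>
    then obtain I where "instance_over S I" "sat_mso I ?p" using fr sent by blast
    then have "is_model S (set D) (set rs) I" "\<not> sat_mso I p"
      using sat_refutation[OF D rs p] by auto
    then show "\<not> entails S (set D) (set rs) (q, p)" using entails_iff_mso[OF q] by blast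
  }
qed

section \<open>Semidecidability of both answers\<close>

text \<open>The translation of terms enters through its graph \<open>T\<close>, so it only has to be
  semidecidable as a relation; the image \<open>b\<close> is guessed and then checked.\<close>

definition coded_map :: "(nat \<Rightarrow> nat \<Rightarrow> bool) \<Rightarrow> nat \<Rightarrow> nat \<Rightarrow> bool" where
  "coded_map T a b \<longleftrightarrow> pfst b = pfst a \<and> clen (psnd b) = clen (psnd a) \<and>
     (\<forall>j<clen (psnd a). T (cnth (psnd a) j) (cnth (psnd b) j))"

text \<open>The codes of \<open>Var x\<close> and \<open>Cst c\<close> are \<open>2 * x\<close> and \<open>2 * c + 1\<close>, those of \<open>Const c\<close> and
  \<open>Null n\<close> are \<open>2 * c\<close> and \<open>2 * n + 1\<close>.\<close>

definition coded_val :: "nat \<Rightarrow> nat \<Rightarrow> nat \<Rightarrow> bool" where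
  "coded_val v t y \<longleftrightarrow>
     (\<exists>x. t = 2 * x \<and> y = cnth v x) \<or> (\<exists>c. t = Suc (2 * c) \<and> y = 2 * c)"

text \<open>Here \<open>pfst r\<close> codes the body, and \<open>2 * x\<close> is searched among
  the argument codes of its atoms. The case of an existential variable is spelled out with bounded
  quantifiers and inequality, since a negation would not be covered by the closure rules.\<close>

definition coded_skolem :: "nat \<Rightarrow> nat \<Rightarrow> nat \<Rightarrow> nat \<Rightarrow> bool" where
  "coded_skolem r v t y \<longleftrightarrow>
     (\<exists>x. t = 2 * x \<and>
       ((\<exists>j. j < clen (pfst r) \<and> (\<exists>k. k < clen (psnd (cnth (pfst r) j)) \<and>
            cnth (psnd (cnth (pfst r) j)) k = 2 * x)) \<and> y = cnth v x \<or>
        (\<forall>j<clen (pfst r). \<forall>k<clen (psnd (cnth (pfst r) j)).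
            cnth (psnd (cnth (pfst r) j)) k \<noteq> 2 * x) \<and> y = Suc (2 * pair r (pair x v)))) \<or>
     (\<exists>c. t = Suc (2 * c) \<and> y = 2 * c)"

text \<open>\<open>K\<close> codes the list of the fixed rules, and entry 3 of
  \<open>enc_query\<close> is the list of query rules. The bound \<open>k < i\<close> confines body
  atoms to earlier entries of the derivation.\<close>

definition coded_step :: "nat \<Rightarrow> nat \<Rightarrow> nat \<Rightarrow> nat \<Rightarrow> nat \<Rightarrow> bool" where
  "coded_step K d q s i \<longleftrightarrow>
     (\<exists>j. j < clen d \<and> cnth s i = cnth d j) \<or>
     (\<exists>r. ((\<exists>j. j < clen K \<and> r = cnth K j) \<or> (\<exists>j. j < clen (cnth q 3) \<and> r = cnth (cnth q 3) j)) \<and>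
       (\<exists>v. (\<forall>j<clen (pfst r). \<exists>k. k < i \<and> coded_map (coded_val v) (cnth (pfst r) j) (cnth s k)) \<and>
         (\<exists>j. j < clen (psnd r) \<and> coded_map (coded_skolem r v) (cnth (psnd r) j) (cnth s i))))"

text \<open>Entry 2 of \<open>enc_query\<close> is the goal predicate, and 0 is the code of its
  empty argument list.\<close>

definition coded_entails :: "nat \<Rightarrow> nat \<Rightarrow> nat \<Rightarrow> bool" where
  "coded_entails K d q \<longleftrightarrow> (\<exists>s. (\<exists>i. i < clen s \<and> cnth s i = pair (cnth q 2) 0) \<and>
     (\<forall>i<clen s. coded_step K d q s i))"

text \<open>The entries of the list \<open>s\<close> are the codes of the conjunctions for the suffixes of the database.\<close>

definition coded_mso_db :: "nat \<Rightarrow> nat \<Rightarrow> bool" where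
  "coded_mso_db d z \<longleftrightarrow> (\<exists>s. z = cnth s 0 \<and> cnth s (clen d) = enc_mso (mso_conj []) \<and>
     (\<forall>i<clen d. \<exists>a. coded_map (\<lambda>t y. y = Suc t) (cnth d i) a \<and>
       cnth s i = pair 4 (pair (pair 0 a) (cnth s (Suc i)))))"

lemma semidec_coded_entails:
  "semidec (Suc (Suc (Suc 0))) (\<lambda>xs. coded_entails K (hd xs) (hd (tl xs)))"
  unfolding coded_entails_def coded_step_def coded_map_def coded_val_def coded_skolem_def
  by (rule trec)+

lemma semidec_halts2:
  assumes "total_rec n A" "total_rec n B"
  shows "semidec n (\<lambda>xs. halts f [A xs, B xs])"
  by (rule semidec_comp[OF semidec_halts]) (rule vec_rec_Cons vec_rec_Nil assms)+

text \<open>The tags 4 and 3 are those of \<open>MAnd\<close> and \<open>MNot\<close>. With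
  \<open>z\<close> the code of the database sentence and \<open>c\<close> that of the rules, the
  second argument of \<open>f\<close> is the code of \<open>refutation\<close>.\<close>

lemma semidec_coded_halts:
  "semidec (Suc (Suc (Suc 0))) (\<lambda>xs. \<exists>n z. coded_mso_db (hd xs) z \<and>
     halts f [n, pair 4 (pair z (pair 4 (pair c (pair 3 (hd (tl (tl xs)))))))])"
  unfolding coded_mso_db_def coded_map_def
  by (rule trec semidec_halts2)+

section \<open>Correctness of the relations on codes\<close>

lemma coded_map_iff:
  assumes "\<And>t y. t \<in> set_atom a \<Longrightarrow> T (e t) y \<longleftrightarrow> y = e' (f t)"
  shows "coded_map T (enc_atom e a) b \<longleftrightarrow> b = enc_atom e' (map_atom f a)"
proof (cases a)
  case (Atom p ts)
  define bs where "bs = list_decode (psnd b)"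
  \<comment> \<open>Pairing and list coding are bijective, so every number splits like this and no
    test for well-formed codes is needed.\<close>
  have b: "b = pair (pfst b) (list_encode bs)" by (simp add: bs_def)
  have "coded_map T (enc_atom e a) b \<longleftrightarrow>
    pfst b = enc_pred p \<and> length bs = length ts \<and> (\<forall>j<length ts. T (e (ts ! j)) (bs ! j))"
    by (subst b) (auto simp: coded_map_def Atom simp flip: pair_def)
  also have "\<dots> \<longleftrightarrow> pfst b = enc_pred p \<and> bs = map (\<lambda>t. e' (f t)) ts"
    using assms by (auto simp: list_eq_iff_nth_eq Atom)
  also have "\<dots> \<longleftrightarrow> b = enc_atom e' (map_atom f a)"
    by (subst (2) b) (simp add: Atom list_encode_eq o_def flip: pair_def)
  finally show ?thesis .
qed

lemma enc_trm_simps: "enc_trm (Var x) = 2 * x" "enc_trm (Cst c) = Suc (2 * c)"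
  by (simp_all add: sum_encode_def)

lemma enc_gterm_simps: "enc_gterm (Const c) = 2 * c" "enc_gterm (Null n) = Suc (2 * n)"
  by (simp_all add: sum_encode_def)

lemma cnth_valuation: "cnth (list_encode (map enc_gterm vs)) x = enc_gterm (lval vs x)"
  by (simp add: lval_def sum_encode_def)

lemma double_neq: "2 * x \<noteq> Suc (2 * y)" "Suc (2 * y) \<noteq> 2 * x" for x y :: nat
  by presburger+

lemma coded_val_iff:
  "coded_val (list_encode (map enc_gterm vs)) (enc_trm t) y \<longleftrightarrow> y = enc_gterm (tval (lval vs) t)"
  by (cases t) (simp_all add: coded_val_def cnth_valuation enc_trm_simps enc_gterm_simps double_neq
      del: enc_gterm.simps enc_trm.simps cnth_list_encode)

lemma coded_body_var:
  "x \<in> body_vars (Rule B H) \<longleftrightarrow> (\<exists>j<length B. \<exists>k<length (args (B ! j)). enc_trm (args (B ! j) ! k) = 2 * x)"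
proof -
  have "x \<in> tvars t \<longleftrightarrow> enc_trm t = 2 * x" for t
    by (cases t) (auto simp: enc_trm_simps double_neq simp del: enc_trm.simps)
  moreover have "set_atom a = set (args a)" for a :: "trm atom" by (cases a) simp
  ultimately show ?thesis by (simp add: body_vars_def avars_def Bex_def in_set_conv_nth) blast
qed

lemma enc_atom_alt: "enc_atom e a = pair (enc_pred (pred_of a)) (list_encode (map e (args a)))"
  by (cases a) (simp add: pair_def)

lemma enc_rule_alt: "enc_rule r = pair (list_encode (map (enc_atom enc_trm) (body r)))
   (list_encode (map (enc_atom enc_trm) (head r)))"
  by (cases r) (simp add: pair_def)

lemma coded_skolem_iff:
  "coded_skolem (enc_rule r) (list_encode (map enc_gterm vs)) (enc_trm t) y \<longleftrightarrow>
     y = enc_gterm (tval (skolem r vs) t)"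
proof (cases t)
  case (Var x)
  let ?B = "\<exists>j<length (body r). \<exists>k<length (args (body r ! j)). enc_trm (args (body r ! j) ! k) = 2 * x"
  have B: "x \<in> body_vars r \<longleftrightarrow> ?B" using coded_body_var[of x "body r" "head r"] by simp
  have "(\<exists>j. j < clen (pfst (enc_rule r)) \<and> (\<exists>k. k < clen (psnd (cnth (pfst (enc_rule r)) j)) \<and>
            cnth (psnd (cnth (pfst (enc_rule r)) j)) k = 2 * x)) \<longleftrightarrow> ?B"
    unfolding enc_rule_alt enc_atom_alt by (auto simp del: enc_trm.simps)
  moreover have "(\<forall>j<clen (pfst (enc_rule r)). \<forall>k<clen (psnd (cnth (pfst (enc_rule r)) j)).
            cnth (psnd (cnth (pfst (enc_rule r)) j)) k \<noteq> 2 * x) \<longleftrightarrow> \<not> ?B"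
    unfolding enc_rule_alt enc_atom_alt by (auto simp del: enc_trm.simps)
  ultimately show ?thesis unfolding Var coded_skolem_def
    by (auto simp: skolem_def B cnth_valuation enc_trm_simps enc_gterm_simps double_neq
      simp del: enc_gterm.simps enc_trm.simps cnth_list_encode)
qed (auto simp: coded_skolem_def enc_trm_simps enc_gterm_simps double_neq
      simp del: enc_gterm.simps enc_trm.simps)

lemma surj_enc_atom:
  assumes "surj e"
  shows "surj (enc_atom e)"
proof (rule surjI)
  fix n
  have "map (e \<circ> inv e) xs = xs" for xs using assms by (simp add: surj_iff)
  then show "enc_atom e (Atom (Pred (pfst (pfst n)) (psnd (pfst n))) (map (inv e) (list_decode (psnd n)))) = n"
    by (simp flip: pair_def)
qed

text \<open>A surjective encoding of entries makes every number the code of a list of objects, so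
  the unrestricted quantifiers over valuations and derivations are faithful.\<close>

lemma ex_list_code:
  assumes "surj e"
  shows "(\<exists>s. P s) \<longleftrightarrow> (\<exists>xs. P (list_encode (map e xs)))"
proof
  assume "\<exists>s. P s"
  then obtain s where "P s" by blast
  moreover have "map (e \<circ> inv e) (list_decode s) = list_decode s" using assms by (simp add: surj_iff)
  then have "list_encode (map e (map (inv e) (list_decode s))) = s" by simp
  ultimately show "\<exists>xs. P (list_encode (map e xs))" by metis
qed blast

lemma coded_step_iff:
  assumes "i < length s"
  shows "coded_step (list_encode (map enc_rule rs)) (enc_db D) (enc_query q)
      (list_encode (map (enc_atom enc_gterm) s)) i \<longleftrightarrow>
    chase_step (set D) (set rs \<union> set (rules q)) (set (take i s)) (s ! i)"
proof -
  let ?e = "enc_atom enc_gterm"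
  let ?s = "list_encode (map ?e s)"
  let ?body = "\<lambda>c v. \<forall>j<clen (pfst c). \<exists>k. k < i \<and>
      coded_map (coded_val v) (cnth (pfst c) j) (cnth ?s k)"
  let ?head = "\<lambda>c v. \<exists>j. j < clen (psnd c) \<and>
      coded_map (coded_skolem c v) (cnth (psnd c) j) (cnth ?s i)"
  have inj: "?e a = ?e b \<longleftrightarrow> a = b" for a b using inj_enc_atom[OF inj_enc_gterm] by (simp add: inj_eq)
  have q3: "cnth (enc_query q) 3 = list_encode (map enc_rule (rules q))"
    by (cases q) (simp add: numeral_3_eq_3 del: list_encode.simps)
  have D: "(\<exists>j. j < clen (enc_db D) \<and> cnth ?s i = cnth (enc_db D) j) \<longleftrightarrow> s ! i \<in> set D"
    using assms by (simp add: enc_db_def inj in_set_conv_nth eq_commute[of "s ! i"] cong: conj_cong)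
  have R: "(\<exists>j. j < clen (list_encode (map enc_rule rs)) \<and> c = cnth (list_encode (map enc_rule rs)) j) \<or>
      (\<exists>j. j < clen (cnth (enc_query q) 3) \<and> c = cnth (cnth (enc_query q) 3) j) \<longleftrightarrow>
      (\<exists>r\<in>set rs \<union> set (rules q). c = enc_rule r)" for c
    unfolding q3 by (simp add: in_set_conv_nth Bex_def Un_iff cong: conj_cong) blast
  have body: "?body (enc_rule r) (list_encode (map enc_gterm vs)) \<longleftrightarrow>
    (\<forall>b\<in>set (body r). map_atom (tval (lval vs)) b \<in> set (take i s))" for r vs
  proof -
    have "coded_map (coded_val (list_encode (map enc_gterm vs))) (enc_atom enc_trm b) y \<longleftrightarrow>
      y = ?e (map_atom (tval (lval vs)) b)" for b y
      by (rule coded_map_iff) (rule coded_val_iff)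
    moreover have "a \<in> set (take i s) \<longleftrightarrow> (\<exists>k<i. s ! k = a)" for a
      using assms by (auto simp: in_set_conv_nth)
    ultimately show ?thesis
      using assms by (simp add: enc_rule_alt inj all_set_conv_all_nth cong: conj_cong)
  qed
  have head: "?head (enc_rule r) (list_encode (map enc_gterm vs)) \<longleftrightarrow>
    (\<exists>h\<in>set (head r). s ! i = map_atom (tval (skolem r vs)) h)" for r vs
  proof -
    have "coded_map (coded_skolem (enc_rule r) (list_encode (map enc_gterm vs))) (enc_atom enc_trm b) y \<longleftrightarrow>
      y = ?e (map_atom (tval (skolem r vs)) b)" for b y
      by (rule coded_map_iff) (rule coded_skolem_iff)
    moreover have "psnd (enc_rule r) = list_encode (map (enc_atom enc_trm) (head r))"
      by (simp add: enc_rule_alt)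
    ultimately show ?thesis
      using assms by (simp add: inj in_set_conv_nth Bex_def cong: conj_cong) blast
  qed
  have ex: "(\<exists>c. (\<exists>r\<in>A. c = enc_rule r) \<and> P c) \<longleftrightarrow> (\<exists>r\<in>A. P (enc_rule r))" for A P by blast
  have step: "(\<exists>v. ?body (enc_rule r) v \<and> ?head (enc_rule r) v) \<longleftrightarrow>
    (\<exists>vs. (\<forall>b\<in>set (body r). map_atom (tval (lval vs)) b \<in> set (take i s)) \<and>
      (\<exists>h\<in>set (head r). s ! i = map_atom (tval (skolem r vs)) h))" for r
    unfolding ex_list_code[OF surj_enc_gterm, of "\<lambda>v. ?body (enc_rule r) v \<and> ?head (enc_rule r) v"]
      body head ..
  show ?thesis
    unfolding coded_step_def chase_step_def D R ex step ..
qed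

lemma coded_entails_iff:
  "coded_entails (list_encode (map enc_rule rs)) (enc_db D) (enc_query q) \<longleftrightarrow>
     Atom (goal q) [] \<in> chase (set D) (set rs \<union> set (rules q))"
proof -
  have q2: "pair (cnth (enc_query q) 2) 0 = enc_atom enc_gterm (Atom (goal q) [])"
    by (cases q) (simp add: numeral_2_eq_2 pair_def del: list_encode.simps(2))
  have inj: "enc_atom enc_gterm a = enc_atom enc_gterm b \<longleftrightarrow> a = b" for a b
    using inj_enc_atom[OF inj_enc_gterm] by (simp add: inj_eq)
  let ?K = "list_encode (map enc_rule rs)"
  have "coded_entails ?K (enc_db D) (enc_query q) \<longleftrightarrow>
    (\<exists>s. (\<exists>i<length s. s ! i = Atom (goal q) []) \<and>
      (\<forall>i<length s. chase_step (set D) (set rs \<union> set (rules q)) (set (take i s)) (s ! i)))"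
    unfolding coded_entails_def q2
      ex_list_code[OF surj_enc_atom[OF surj_enc_gterm], of "\<lambda>s. (\<exists>i. i < clen s \<and>
        cnth s i = enc_atom enc_gterm (Atom (goal q) [])) \<and> (\<forall>i<clen s. coded_step ?K (enc_db D) (enc_query q) s i)"]
    by (simp add: coded_step_iff inj del: enc_atom.simps cong: conj_cong)
  then show ?thesis by (auto simp: chase_iff_sequence chase_sequence_def in_set_conv_nth)
qed

lemma coded_mso_db_iff:
  assumes "adom (set D) \<subseteq> range Const"
  shows "coded_mso_db (enc_db D) z \<longleftrightarrow> z = enc_mso (mso_db D)"
proof -
  let ?F = "\<lambda>a y. pair 4 (pair (pair 0 (enc_atom enc_trm (map_atom trm_of a))) y)"
  \<comment> \<open>\<open>Const c\<close> has code \<open>2 * c\<close> and \<open>Cst c\<close>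
    has code \<open>2 * c + 1\<close>, so on database terms \<open>trm_of\<close> is the successor
    on codes.\<close>
  have *: "coded_map (\<lambda>t y. y = Suc t) (enc_atom enc_gterm a) y \<longleftrightarrow> y = enc_atom enc_trm (map_atom trm_of a)"
    if a: "a \<in> set D" for a y
  proof (rule coded_map_iff)
    fix t y assume "t \<in> set_atom a"
    then obtain c where "t = Const c" using assms a unfolding adom_def by blast
    then show "y = Suc (enc_gterm t) \<longleftrightarrow> y = enc_trm (trm_of t)" by (simp add: sum_encode_def)
  qed
  have db: "enc_mso (mso_db D) = foldr ?F D (enc_mso (mso_conj []))" for D
    by (induction D) (simp_all add: mso_db_def mso_conj_def flip: pair_def)
  have "coded_mso_db (enc_db D) z \<longleftrightarrow> (\<exists>s. z = cnth s 0 \<and> cnth s (length D) = enc_mso (mso_conj []) \<and>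
     (\<forall>i<length D. cnth s i = ?F (D ! i) (cnth s (Suc i))))"
    unfolding coded_mso_db_def enc_db_def by (simp add: *)
  also have "\<dots> \<longleftrightarrow> z = foldr ?F D (enc_mso (mso_conj []))"
  proof
    assume "\<exists>s. z = cnth s 0 \<and> cnth s (length D) = enc_mso (mso_conj []) \<and>
     (\<forall>i<length D. cnth s i = ?F (D ! i) (cnth s (Suc i)))"
    then obtain s where s: "z = cnth s 0" "cnth s (length D) = enc_mso (mso_conj [])"
      "\<And>i. i < length D \<Longrightarrow> cnth s i = ?F (D ! i) (cnth s (Suc i))" by blast
    \<comment> \<open>Each entry is determined by the next one, so the induction runs downwards from
      the entry for the empty suffix.\<close>
    have "cnth s i = foldr ?F (drop i D) (enc_mso (mso_conj []))" if "i \<le> length D" for i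
      using that
    proof (induction rule: inc_induct)
      case (step n)
      then show ?case using s(3)[of n] by (simp flip: Cons_nth_drop_Suc)
    qed (simp add: s(2))
    from this[of 0] show "z = foldr ?F D (enc_mso (mso_conj []))" by (simp add: s(1))
  next
    assume z: "z = foldr ?F D (enc_mso (mso_conj []))"
    let ?s = "map (\<lambda>i. foldr ?F (drop i D) (enc_mso (mso_conj []))) [0..<Suc (length D)]"
    have nth: "cnth (list_encode ?s) i = foldr ?F (drop i D) (enc_mso (mso_conj []))" if "i \<le> length D" for i
      using that by (simp del: upt_Suc)
    show "\<exists>s. z = cnth s 0 \<and> cnth s (length D) = enc_mso (mso_conj []) \<and>
     (\<forall>i<length D. cnth s i = ?F (D ! i) (cnth s (Suc i)))"
    proof (intro exI[of _ "list_encode ?s"] conjI allI impI)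
      fix i assume "i < length D"
      then show "cnth (list_encode ?s) i = ?F (D ! i) (cnth (list_encode ?s) (Suc i))"
        by (simp add: nth del: upt_Suc cnth_list_encode flip: Cons_nth_drop_Suc)
    qed (simp_all add: nth z del: upt_Suc cnth_list_encode)
  qed
  finally show ?thesis by (simp add: db)
qed

theorem theorem5:
  fixes S :: signature and w :: width_measure and R :: "rule set"
  assumes "finite S"
    and "mso_friendly S w"
    and "finite R" and "\<forall>r\<in>R. rule_over S r"
    and "finite_width_set S w R"
  shows "decidable_on
     {(D, q, p). database S (set D) \<and> damsoq S q p}
     (\<lambda>(D, q, p). [enc_db D, enc_query q, enc_mso p])
     (\<lambda>(D, q, p). entails S (set D) R (q, p))"
proof -
  obtain rs where rs: "R = set rs" using finite_list[OF assms(3)] by blast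
  obtain f where f: "\<forall>n p. mso_sentence S p \<longrightarrow>
        ((\<nexists>I. instance_over S I \<and> sat_mso I p) \<longrightarrow> \<not> halts f [n, enc_mso p]) \<and>
        ((\<exists>I. instance_over S I \<and> sat_mso I p \<and> w I \<le> enat n) \<longrightarrow> halts f [n, enc_mso p])"
    using assms(2) unfolding mso_friendly_def by blast
  \<comment> \<open>The rules are not part of the input, so the code of their sentence, like the
    code of the rule list, is a constant built into the program.\<close>
  define c where "c = enc_mso (mso_conj (map mso_rule rs))"
  show ?thesis
  proof (rule decidable_on_if_semidec[OF semidec_coded_entails[of "list_encode (map enc_rule rs)"]
          semidec_coded_halts[of f c]], goal_cases)
    case (1 x)
    then show ?case by auto
  next
    case (2 x)
    then obtain D q p where x: "x = (D, q, p)" "database S (set D)" "damsoq S q p" by auto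
    then have "entails S (set D) R (q, p) \<longleftrightarrow> Atom (goal q) [] \<in> chase (set D) (set rs \<union> set (rules q))"
      using entails_iff_chase assms(4) rs by (simp add: damsoq_def)
    then show ?case unfolding x by (simp add: coded_entails_iff)
  next
    case (3 x)
    then obtain D q p where x: "x = (D, q, p)" "database S (set D)" "damsoq S q p" by auto
    have "enc_mso (refutation D rs p) = pair 4 (pair (enc_mso (mso_db D)) (pair 4 (pair c (pair 3 (enc_mso p)))))"
      by (simp add: refutation_def c_def pair_def)
    moreover have "\<not> entails S (set D) R (q, p) \<longleftrightarrow> (\<exists>n. halts f [n, enc_mso (refutation D rs p)])"
      using not_entails_iff_halts[OF f] assms(4,5) x rs by blast
    ultimately show ?case
      using x(2) unfolding x by (simp add: coded_mso_db_iff database_def)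
  qed
qed

end
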